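(* Let $g=\theta\circ\lambda:\mathbf{S}^n\to(-\infty,\infty]$ be a spectral function (with $\theta(x)=g(\mathrm{Diag}(x))$) that is locally Lipschitz continuous relative to its domain, lower semicontinuous and convex. Let $\mu_1>\dots>\mu_r$ be the distinct eigenvalues of $X$. (a) If $Y\in\partial g(X)$ and $\theta$ is parabolically regular at $\lambda(X)$ for $\lambda(Y)$ and parabolically epi-differentiable at $\lambda(X)$, then $g$ is parabolically regular at $X$ for $Y$, and for every $H\in K_g(X,Y)$ and every $U\in\mathbf{O}^n(X)\cap\mathbf{O}^n(Y)$, $$\mathrm{d}^2g(X,Y)(H)=\mathrm{d}^2\theta(\lambda(X),\lambda(Y))(\lambda'(X;H))+2\sum_{m=1}^r\big\langle\Lambda(Y)_{\alpha_m\alpha_m},U_{\alpha_m}^\top H(\mu_mI-X)^\dagger HU_{\alpha_m}\big\rangle.$$ (b) If $g$ is parabolically epi-differentiable and parabolically regular at $X$, then $\theta$ is parabolically regular at $\lambda(X)$.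
   Context: $\mathbf{S}^n$: real symmetric matrices with trace inner product. $\lambda(X)$: eigenvalues in nonincreasing order; $\mathbf{O}^n(X)=\{U\text{ orthogonal}:X=U\mathrm{Diag}(\lambda(X))U^\top\}$. $\alpha_m=\{i:\lambda_i(X)=\mu_m\}$; $U_{\alpha_m}$: columns of $U$ indexed by $\alpha_m$; $\Lambda(Y)=\mathrm{Diag}(\lambda(Y))$, $\Lambda(Y)_{\alpha_m\alpha_m}$ its principal submatrix on $\alpha_m$; $Z^\dagger$: Moore–Penrose inverse. $\partial$: convex subdifferential. $\lambda'(X;H)=\lim_{t\downarrow0}(\lambda(X+tH)-\lambda(X))/t$. Locally Lipschitz relative to domain: around each point of $\mathrm{dom}\,g$, $|g(A)-g(B)|\le\ell\|A-B\|$ for $A,B$ in a neighborhood intersected with $\mathrm{dom}\,g$. Subderivative $\mathrm{d}f(\bar x)(\bar w)=\liminf_{t\downarrow0,w\to\bar w}\frac{f(\bar x+tw)-f(\bar x)}{t}$; critical cone $K_f(\bar x,\bar v)=\{w:\mathrm{d}f(\bar x)(w)=\langle\bar v,w\rangle\}$; parabolic subderivative $\mathrm{d}^2f(\bar x)(w|z)=\liminf_{t\downarrow0,z'\to z}\frac{f(\bar x+tw+\frac12t^2z')-f(\bar x)-t\mathrm{d}f(\bar x)(w)}{\frac12t^2}$ (for $\mathrm{d}f(\bar x)(w)$ finite); $f$ is parabolically epi-differentiable at $\bar x$ if for each $w$ with $\mathrm{d}f(\bar x)(w)$ finite, $\{z:\mathrm{d}^2f(\bar x)(w|z)<\infty\}\neq\emptyset$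 and for every $z$ and $t_k\downarrow0$ there is $z_k\to z$ with the difference quotients $\frac{f(\bar x+t_kw+\frac12t_k^2z_k)-f(\bar x)-t_k\mathrm{d}f(\bar x)(w)}{\frac12t_k^2}\to\mathrm{d}^2f(\bar x)(w|z)$. Second subderivative $\mathrm{d}^2f(\bar x,\bar v)(w)=\liminf_{t\downarrow0,w'\to w}\Delta^2_tf(\bar x,\bar v)(w')$ with $\Delta^2_tf(\bar x,\bar v)(w)=\frac{f(\bar x+tw)-f(\bar x)-t\langle\bar v,w\rangle}{\frac12t^2}$. A convex $f$ is parabolically regular at $\bar x$ for $\bar v\in\partial f(\bar x)$ if for every $w$ with $\mathrm{d}^2f(\bar x,\bar v)(w)<\infty$, among sequences $t_k\downarrow0,w_k\to w$ with $\Delta^2_{t_k}f(\bar x,\bar v)(w_k)\to\mathrm{d}^2f(\bar x,\bar v)(w)$ there are ones with $\limsup_k\|w_k-w\|/t_k<\infty$; parabolically regular at $\bar x$ if so for every $\bar v\in\partial f(\bar x)$. *)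

theory Defs
  imports "HOL-Analysis.Analysis"
begin

definition edom :: "('a \<Rightarrow> ereal) \<Rightarrow> 'a set" where
  "edom f = {x. f x < \<infinity>}"

definition convex_efun :: "('a::real_vector \<Rightarrow> ereal) \<Rightarrow> bool" where
  "convex_efun f \<longleftrightarrow> (\<forall>x y t. 0 \<le> t \<and> t \<le> 1 \<longrightarrow>
      f ((1 - t) *\<^sub>R x + t *\<^sub>R y) \<le> ereal (1 - t) * f x + ereal t * f y)"

definition lsc_efun :: "('a::topological_space \<Rightarrow> ereal) \<Rightarrow> bool" where
  "lsc_efun f \<longleftrightarrow> (\<forall>x. f x \<le> Liminf (at x) f)"

definition loc_lipschitz_rel_dom :: "('a::metric_space \<Rightarrow> ereal) \<Rightarrow> bool" where
  "loc_lipschitz_rel_dom f \<longleftrightarrow> (\<forall>x\<in>edom f. \<exists>l e. e > 0 \<and>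
     (\<forall>a\<in>ball x e \<inter> edom f. \<forall>b\<in>ball x e \<inter> edom f.
        \<bar>real_of_ereal (f a) - real_of_ereal (f b)\<bar> \<le> l * dist a b))"

definition subdiff :: "('a::real_inner \<Rightarrow> ereal) \<Rightarrow> 'a \<Rightarrow> 'a set" where
  "subdiff f x = {v. f x \<noteq> \<infinity> \<and> f x \<noteq> -\<infinity> \<and>
      (\<forall>y. f x + ereal (inner v (y - x)) \<le> f y)}"

definition subderiv :: "('a::real_normed_vector \<Rightarrow> ereal) \<Rightarrow> 'a \<Rightarrow> 'a \<Rightarrow> ereal" where
  "subderiv f x w = Liminf (at_right (0::real) \<times>\<^sub>F nhds w)
      (\<lambda>(t, w'). (f (x + t *\<^sub>R w') - f x) / ereal t)"

definition critical_cone :: "('a::real_inner \<Rightarrow> ereal) \<Rightarrow> 'a \<Rightarrow> 'a \<Rightarrow> 'a set" where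
  "critical_cone f x v = {w. subderiv f x w = ereal (inner v w)}"

definition par_quot :: "('a::real_normed_vector \<Rightarrow> ereal) \<Rightarrow> 'a \<Rightarrow> 'a \<Rightarrow> real \<Rightarrow> 'a \<Rightarrow> ereal" where
  "par_quot f x w t z = (f (x + t *\<^sub>R w + (t\<^sup>2 / 2) *\<^sub>R z) - f x - ereal t * subderiv f x w)
      / ereal (t\<^sup>2 / 2)"

definition par_subderiv :: "('a::real_normed_vector \<Rightarrow> ereal) \<Rightarrow> 'a \<Rightarrow> 'a \<Rightarrow> 'a \<Rightarrow> ereal" where
  "par_subderiv f x w z = Liminf (at_right (0::real) \<times>\<^sub>F nhds z) (\<lambda>(t, z'). par_quot f x w t z')"

definition par_epi_diff :: "('a::real_normed_vector \<Rightarrow> ereal) \<Rightarrow> 'a \<Rightarrow> bool" where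
  "par_epi_diff f x \<longleftrightarrow> (\<forall>w. \<bar>subderiv f x w\<bar> \<noteq> \<infinity> \<longrightarrow>
      {z. par_subderiv f x w z < \<infinity>} \<noteq> {} \<and>
      (\<forall>z t. (\<forall>k. t k > 0) \<and> t \<longlonglongrightarrow> 0 \<longrightarrow>
         (\<exists>zk. zk \<longlonglongrightarrow> z \<and> (\<lambda>k. par_quot f x w (t k) (zk k)) \<longlonglongrightarrow> par_subderiv f x w z)))"

definition sec_quot :: "('a::real_inner \<Rightarrow> ereal) \<Rightarrow> 'a \<Rightarrow> 'a \<Rightarrow> real \<Rightarrow> 'a \<Rightarrow> ereal" where
  "sec_quot f x v t w = (f (x + t *\<^sub>R w) - f x - ereal (t * inner v w)) / ereal (t\<^sup>2 / 2)"

definition sec_subderiv :: "('a::real_inner \<Rightarrow> ereal) \<Rightarrow> 'a \<Rightarrow> 'a \<Rightarrow> 'a \<Rightarrow> ereal" where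
  "sec_subderiv f x v w = Liminf (at_right (0::real) \<times>\<^sub>F nhds w) (\<lambda>(t, w'). sec_quot f x v t w')"

definition par_regular_for :: "('a::real_inner \<Rightarrow> ereal) \<Rightarrow> 'a \<Rightarrow> 'a \<Rightarrow> bool" where
  "par_regular_for f x v \<longleftrightarrow> (\<forall>w. sec_subderiv f x v w < \<infinity> \<longrightarrow>
     (\<exists>t wk. (\<forall>k. t k > 0) \<and> t \<longlonglongrightarrow> 0 \<and> wk \<longlonglongrightarrow> w \<and>
        (\<lambda>k. sec_quot f x v (t k) (wk k)) \<longlonglongrightarrow> sec_subderiv f x v w \<and>
        limsup (\<lambda>k. ereal (norm (wk k - w) / t k)) < \<infinity>))"

definition par_regular :: "('a::real_inner \<Rightarrow> ereal) \<Rightarrow> 'a \<Rightarrow> bool" where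
  "par_regular f x \<longleftrightarrow> (\<forall>v\<in>subdiff f x. par_regular_for f x v)"

text \<open>Matrices are real^'n^'n; the index type carries a linear order giving the
  positions 1..n.  The inner product on real^'n^'n is the trace inner product.\<close>

definition symmetric_mat :: "real^'n^'n \<Rightarrow> bool" where
  "symmetric_mat X \<longleftrightarrow> transpose X = X"

definition Diag :: "real^'n \<Rightarrow> real^'n^'n" where
  "Diag x = (\<chi> i j. if i = j then x $ i else 0)"

definition nonincreasing_vec :: "real^('n::{finite,linorder}) \<Rightarrow> bool" where
  "nonincreasing_vec x \<longleftrightarrow> (\<forall>i j. i \<le> j \<longrightarrow> x $ j \<le> x $ i)"

text \<open>lambda(X): eigenvalues in nonincreasing order (meaningful for symmetric X).\<close>
definition eigs :: "real^('n::{finite,linorder})^('n::{finite,linorder}) \<Rightarrow> real^('n::{finite,linorder})" where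
  "eigs X = (THE x. nonincreasing_vec x \<and>
      (\<exists>U. orthogonal_matrix U \<and> X = U ** Diag x ** transpose U))"

definition orth_diag :: "real^('n::{finite,linorder})^('n::{finite,linorder}) \<Rightarrow> (real^('n::{finite,linorder})^('n::{finite,linorder})) set" where
  "orth_diag X = {U. orthogonal_matrix U \<and> X = U ** Diag (eigs X) ** transpose U}"

definition eigs_dir :: "real^('n::{finite,linorder})^('n::{finite,linorder}) \<Rightarrow> real^('n::{finite,linorder})^('n::{finite,linorder}) \<Rightarrow> real^('n::{finite,linorder})" where
  "eigs_dir X H = Lim (at_right (0::real)) (\<lambda>t. (1 / t) *\<^sub>R (eigs (X + t *\<^sub>R H) - eigs X))"

definition mp_inv :: "real^'n^'n \<Rightarrow> real^'n^'n" where
  "mp_inv A = (THE B. A ** B ** A = A \<and> B ** A ** B = B \<and>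
      transpose (A ** B) = A ** B \<and> transpose (B ** A) = B ** A)"

definition eig_index :: "real^('n::{finite,linorder})^('n::{finite,linorder}) \<Rightarrow> real \<Rightarrow> ('n::{finite,linorder}) set" where
  "eig_index X mu = {i. eigs X $ i = mu}"

text \<open>The curvature term 2 sum_m < Lambda(Y)_{alpha_m alpha_m},
  U_{alpha_m}^T H (mu_m I - X)^+ H U_{alpha_m} >, summing over the distinct
  eigenvalues mu_m of X (trace inner product of the principal blocks written out).\<close>
definition sigma_term :: "real^('n::{finite,linorder})^('n::{finite,linorder}) \<Rightarrow> real^('n::{finite,linorder})^('n::{finite,linorder}) \<Rightarrow> real^('n::{finite,linorder})^('n::{finite,linorder}) \<Rightarrow> real^('n::{finite,linorder})^('n::{finite,linorder}) \<Rightarrow> real" where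
  "sigma_term X Y U H = 2 * (\<Sum>mu\<in>{eigs X $ i | i. True}.
     (let M = transpose U ** H ** mp_inv (mu *\<^sub>R mat 1 - X) ** H ** U in
      \<Sum>i\<in>eig_index X mu. \<Sum>j\<in>eig_index X mu. Diag (eigs Y) $ i $ j * M $ i $ j))"

end

theory Submission
  imports Defs
begin

text \<open>
  Orthogonal invariance reduces everything to \<open>X = Diag x\<close> and \<open>Y = Diag y\<close> with \<open>x\<close>, \<open>y\<close> nonincreasing.
  Write \<open>\<lambda>(X + tK) = x + tq\<close>.  The second difference quotient of \<open>g\<close> at \<open>K\<close> is that of \<open>\<theta>\<close> at \<open>q\<close> plus
  \<open>2(\<langle>y, q\<rangle> - \<langle>Y, K\<rangle>)/t\<close>.  Let \<open>A\<close> be the skew matrix for which \<open>AX - XA\<close> is the part of \<open>H\<close> outside the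
  eigenvalue blocks of \<open>X\<close>, and let \<open>O(t) = I + tA + t\<^sup>2 A\<^sup>2/2 + \<dots>\<close> be its Cayley transform.  Fan's
  inequality tested at \<open>O(t)\<close> bounds the extra term from below by a quantity tending to the curvature
  term.  Conversely, if \<open>h\<^sub>k\<close> is a recovery sequence for \<open>\<theta>\<close> and \<open>Q\<close> diagonalizes the diagonal blocks of
  \<open>H\<close>, then \<open>O(t)Q(X + t Diag h\<^sub>k)Q\<^sup>T O(t)\<^sup>T = X + t H\<^sub>k\<close> gives a recovery sequence \<open>H\<^sub>k\<close> for \<open>g\<close>, and the
  bound on \<open>\<parallel>H\<^sub>k - H\<parallel>/t\<close> is inherited.  Criticality of \<open>H\<close> is what allows \<open>Q\<close> to commute with \<open>Y\<close>.

  In the converse direction, convexity gives \<open>\<theta>(diag Z) \<le> g(Z)\<close> (pinching), so the diagonals of a recovery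
  sequence for \<open>g\<close> at \<open>Diag w\<close> form a recovery sequence for \<open>\<theta>\<close> at \<open>w\<close>.
\<close>

section \<open>Matrix algebra, the trace inner product, symmetric and diagonal matrices\<close>

lemma bounded_bilinear_matrix_mult:
  "bounded_bilinear ((**) :: real^'m^'n \<Rightarrow> real^'k^'m \<Rightarrow> real^'k^'n)"
  unfolding bilinear_conv_bounded_bilinear[symmetric] bilinear_def linear_iff
  by (auto simp: matrix_matrix_mult_def vec_eq_iff algebra_simps sum.distrib sum_distrib_left)

lemmas matrix_mult_bilinear =
  bounded_bilinear.add_left[OF bounded_bilinear_matrix_mult]
  bounded_bilinear.add_right[OF bounded_bilinear_matrix_mult]
  bounded_bilinear.diff_left[OF bounded_bilinear_matrix_mult]
  bounded_bilinear.diff_right[OF bounded_bilinear_matrix_mult]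
  bounded_bilinear.minus_left[OF bounded_bilinear_matrix_mult]
  bounded_bilinear.minus_right[OF bounded_bilinear_matrix_mult]
  bounded_bilinear.scaleR_left[OF bounded_bilinear_matrix_mult]
  bounded_bilinear.scaleR_right[OF bounded_bilinear_matrix_mult]
  bounded_bilinear.zero_left[OF bounded_bilinear_matrix_mult]
  bounded_bilinear.zero_right[OF bounded_bilinear_matrix_mult]

lemmas tendsto_matrix_mult = bounded_bilinear.tendsto[OF bounded_bilinear_matrix_mult]

lemma transpose_add: "transpose (A + B) = transpose A + transpose (B::real^'m^'n)"
  and transpose_diff: "transpose (A - B) = transpose A - transpose (B::real^'m^'n)"
  by (simp_all add: transpose_def vec_eq_iff)

lemma bounded_linear_transpose: "bounded_linear (transpose :: real^'m^'n \<Rightarrow> real^'n^'m)"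
  unfolding linear_conv_bounded_linear[symmetric]
  by (simp add: linear_iff transpose_add transpose_scalar)

lemmas tendsto_transpose = bounded_linear.tendsto[OF bounded_linear_transpose]

lemma matrix_mult_nth: "(A ** B) $ i $ j = (\<Sum>k\<in>UNIV. A $ i $ k * B $ k $ j)"
  by (simp add: matrix_matrix_mult_def)

lemma inner_matrix: "inner A B = (\<Sum>i\<in>UNIV. \<Sum>j\<in>UNIV. A $ i $ j * (B::real^'m^'n) $ i $ j)"
  by (simp add: inner_vec_def)

lemma inner_transpose: "inner (transpose A) B = inner A (transpose (B::real^'n^'m))"
  by (subst (1 2) inner_matrix, subst sum.swap) (simp add: transpose_def)

lemma inner_matrix_mult_left: "inner (A ** B) C = inner B (transpose A ** (C::real^'k^'n))"
proof -
  have "inner (A ** B) C = (\<Sum>i\<in>UNIV. \<Sum>j\<in>UNIV. \<Sum>k\<in>UNIV. A$i$k * B$k$j * C$i$j)"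
    by (simp add: inner_matrix matrix_mult_nth sum_distrib_right)
  also have "\<dots> = (\<Sum>i\<in>UNIV. \<Sum>k\<in>UNIV. \<Sum>j\<in>UNIV. A$i$k * B$k$j * C$i$j)"
    by (intro sum.cong refl sum.swap)
  also have "\<dots> = (\<Sum>k\<in>UNIV. \<Sum>i\<in>UNIV. \<Sum>j\<in>UNIV. A$i$k * B$k$j * C$i$j)"
    by (rule sum.swap)
  also have "\<dots> = (\<Sum>k\<in>UNIV. \<Sum>j\<in>UNIV. \<Sum>i\<in>UNIV. A$i$k * B$k$j * C$i$j)"
    by (intro sum.cong refl sum.swap)
  also have "\<dots> = inner B (transpose A ** C)"
    by (simp add: inner_matrix matrix_mult_nth sum_distrib_left transpose_def mult_ac)
  finally show ?thesis .
qed

lemma inner_matrix_mult_right: "inner (A ** B) C = inner A ((C::real^'k^'n) ** transpose B)"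
proof -
  have "inner (A ** B) C = inner (transpose B ** transpose A) (transpose C)"
    by (simp add: inner_transpose flip: matrix_transpose_mul)
  also have "\<dots> = inner (transpose A) (B ** transpose C)"
    by (simp add: inner_matrix_mult_left)
  also have "\<dots> = inner A (C ** transpose B)"
    by (simp add: inner_transpose matrix_transpose_mul)
  finally show ?thesis .
qed

lemma orthogonal_matrixD:
  fixes Q :: "real^'n^'n"
  assumes "orthogonal_matrix Q"
  shows "transpose Q ** Q = mat 1" "Q ** transpose Q = mat 1"
    "B ** transpose Q ** Q = B" "B ** Q ** transpose Q = B"
proof -
  show 1: "transpose Q ** Q = mat 1" and 2: "Q ** transpose Q = mat 1"
    using assms by (auto simp: orthogonal_matrix_def)
  show "B ** transpose Q ** Q = B" "B ** Q ** transpose Q = B"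
    by (simp_all add: matrix_mul_assoc[symmetric] 1 2)
qed

lemma norm_orthogonal_mult:
  fixes Q :: "real^'n^'n"
  assumes "orthogonal_matrix Q"
  shows "norm (Q ** A) = norm A" "norm (A ** Q) = norm A"
proof -
  have "inner (Q ** A) (Q ** A) = inner A A"
    by (subst inner_matrix_mult_left) (simp add: matrix_mul_assoc orthogonal_matrixD[OF assms])
  then show "norm (Q ** A) = norm A" by (simp add: norm_eq_sqrt_inner)
  have "inner (A ** Q) (A ** Q) = inner A A"
    by (subst inner_matrix_mult_right) (simp add: orthogonal_matrixD[OF assms])
  then show "norm (A ** Q) = norm A" by (simp add: norm_eq_sqrt_inner)
qed

lemma inner_conj: "inner (Q ** A ** transpose Q) B = inner A (transpose Q ** B ** (Q::real^'n^'n))"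
  by (subst inner_matrix_mult_right, subst inner_matrix_mult_left)
     (simp add: matrix_mul_assoc)

lemma inner_orthogonal_conj:
  fixes Q :: "real^'n^'n"
  assumes "orthogonal_matrix Q"
  shows "inner (Q ** A ** transpose Q) (Q ** B ** transpose Q) = inner A B"
  unfolding inner_conj by (simp add: matrix_mul_assoc orthogonal_matrixD[OF assms])

lemma Diag_nth: "Diag x $ i $ j = (if i = j then x $ i else 0)"
  by (simp add: Diag_def)

lemma Diag_mult_nth: "(Diag x ** A) $ i $ j = x $ i * A $ i $ j"
  and mult_Diag_nth: "(A ** Diag x) $ i $ j = A $ i $ j * x $ j"
  by (simp_all add: matrix_mult_nth Diag_nth if_distrib if_distribR sum.delta cong: if_cong)

lemma Diag_add: "Diag (x + y) = Diag x + Diag y"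
  and Diag_diff: "Diag (x - y) = Diag x - Diag y"
  and Diag_scaleR: "Diag (c *\<^sub>R x) = c *\<^sub>R Diag x"
  and transpose_Diag [simp]: "transpose (Diag x) = Diag x"
  by (auto simp: vec_eq_iff Diag_nth transpose_def)

lemma bounded_linear_Diag: "bounded_linear Diag"
  unfolding linear_conv_bounded_linear[symmetric]
  by (simp add: linear_iff Diag_add Diag_scaleR)

lemmas tendsto_Diag = bounded_linear.tendsto[OF bounded_linear_Diag]

lemma transpose_nth: "transpose A $ i $ j = A $ j $ i"
  by (simp add: transpose_def)

lemma symmetric_mat_nth: "symmetric_mat A \<Longrightarrow> A $ i $ j = A $ j $ i"
  using transpose_nth[of A j i] by (simp add: symmetric_mat_def)

lemma symmetric_mat_Diag [simp]: "symmetric_mat (Diag x)"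
  by (simp add: symmetric_mat_def)

lemma symmetric_mat_conj:
  "symmetric_mat A \<Longrightarrow> symmetric_mat (Q ** A ** transpose Q)"
  for A :: "real^'n^'n"
  by (simp add: symmetric_mat_def matrix_transpose_mul matrix_mul_assoc)

lemma symmetric_mat_conj_iff:
  assumes "orthogonal_matrix (Q::real^'n^'n)"
  shows "symmetric_mat (Q ** A ** transpose Q) \<longleftrightarrow> symmetric_mat A"
proof
  assume "symmetric_mat (Q ** A ** transpose Q)"
  from symmetric_mat_conj[OF this, of "transpose Q"] show "symmetric_mat A"
    by (simp add: matrix_mul_assoc orthogonal_matrixD[OF assms])
qed (rule symmetric_mat_conj)

lemma symmetric_mat_add: "symmetric_mat A \<Longrightarrow> symmetric_mat B \<Longrightarrow> symmetric_mat (A + (B::real^'n^'n))"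
  and symmetric_mat_diff: "symmetric_mat A \<Longrightarrow> symmetric_mat B \<Longrightarrow> symmetric_mat (A - (B::real^'n^'n))"
  and symmetric_mat_scaleR: "symmetric_mat A \<Longrightarrow> symmetric_mat (c *\<^sub>R A)"
  by (simp_all add: symmetric_mat_def transpose_add transpose_diff transpose_scalar)

lemma inner_Diag: "inner (Diag y) A = (\<Sum>i\<in>UNIV. y $ i * A $ i $ i)"
  by (simp add: inner_matrix Diag_nth if_distrib if_distribR sum.delta cong: if_cong)

lemma inner_Diag_Diag: "inner (Diag x) (Diag y) = inner x y"
  unfolding inner_Diag by (simp add: Diag_nth inner_vec_def)

lemma norm_Diag: "norm (Diag x) = norm x"
  by (simp add: norm_eq_sqrt_inner inner_Diag_Diag)

lemma conj_Diag_nth_diag: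
  fixes Q :: "real^'n^'n"
  shows "(Q ** Diag z ** transpose Q) $ i $ i = (\<Sum>k\<in>UNIV. (Q $ i $ k)\<^sup>2 * z $ k)"
  unfolding matrix_mult_nth[of "Q ** Diag z"] mult_Diag_nth
  by (intro sum.cong) (auto simp: transpose_def power2_eq_square)

section \<open>Spectral theorem within blocks\<close>

text \<open>Blocks are given by a labelling of the indices: equal entries of \<open>x\<close>, equal
  pairs of entries of \<open>x\<close> and \<open>y\<close>, or a constant label for no
  restriction.\<close>

definition block_mat :: "('n \<Rightarrow> 'c) \<Rightarrow> real^'n^'n \<Rightarrow> bool" where
  "block_mat C A \<longleftrightarrow> (\<forall>k l. C k \<noteq> C l \<longrightarrow> A $ k $ l = 0)"

lemma block_mat_mult: "block_mat C A \<Longrightarrow> block_mat C B \<Longrightarrow> block_mat C (A ** B)"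
  unfolding block_mat_def matrix_mult_nth
  by (intro allI impI sum.neutral ballI) (metis mult_eq_0_iff)

lemma block_mat_transpose: "block_mat C A \<Longrightarrow> block_mat C (transpose A)"
  by (auto simp: block_mat_def transpose_def)

lemma block_mat_Diag: "block_mat C (Diag x)"
  by (auto simp: block_mat_def Diag_nth)

lemma block_mat_commute:
  assumes "block_mat C A" "\<And>k l. C k = C l \<Longrightarrow> x $ k = x $ l"
  shows "A ** Diag x = Diag x ** A"
  unfolding vec_eq_iff mult_Diag_nth Diag_mult_nth
  using assms unfolding block_mat_def by (metis mult.commute mult_zero_left)

lemma block_mat_conj_Diag:
  assumes "block_mat C Q" "orthogonal_matrix Q" "\<And>k l. C k = C l \<Longrightarrow> x $ k = x $ l"
  shows "Q ** Diag x ** transpose Q = Diag x"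
  by (simp add: block_mat_commute[OF assms(1,3)] orthogonal_matrixD[OF assms(2)]
      flip: matrix_mul_assoc)

section \<open>Reflections of a coordinate plane and optimality conditions for orthogonal
  conjugation\<close>

definition plane_refl :: "'n \<Rightarrow> 'n \<Rightarrow> real \<Rightarrow> real \<Rightarrow> real^'n^'n" where
  "plane_refl i j p q = (\<chi> k l. if k = i then (if l = i then p else if l = j then q else 0)
     else if k = j then (if l = i then q else if l = j then - p else 0)
     else if k = l then 1 else 0)"

lemma plane_refl_mult:
  assumes "i \<noteq> j"
  shows "(plane_refl i j p q ** A) $ k =
    (if k = i then p *\<^sub>R A $ i + q *\<^sub>R A $ j else if k = j then q *\<^sub>R A $ i - p *\<^sub>R A $ j else A $ k)"
proof -
  have "(\<Sum>m\<in>UNIV. plane_refl i j p q $ k $ m * A $ m $ l) =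
      (\<Sum>m\<in>UNIV. (if m = i then plane_refl i j p q $ k $ i * A $ i $ l else 0)
        + (if m = j then plane_refl i j p q $ k $ j * A $ j $ l else 0)
        + (if m = k then (if k = i \<or> k = j then 0 else A $ k $ l) else 0))" for l
    by (rule sum.cong) (use assms in \<open>auto simp: plane_refl_def\<close>)
  then have "(plane_refl i j p q ** A) $ k $ l =
      plane_refl i j p q $ k $ i * A $ i $ l + plane_refl i j p q $ k $ j * A $ j $ l
        + (if k = i \<or> k = j then 0 else A $ k $ l)" for l
    by (simp add: matrix_mult_nth sum.distrib sum.delta)
  then show ?thesis
    using assms by (auto simp: vec_eq_iff plane_refl_def)
qed

lemma transpose_plane_refl: "transpose (plane_refl i j p q) = plane_refl i j p q"
  by (auto simp: vec_eq_iff plane_refl_def transpose_def)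

text \<open>A reflection serves better than a rotation here: it is symmetric and hence its own
  inverse once \<open>p\<close> and \<open>q\<close> lie on the unit circle.\<close>

lemma orthogonal_plane_refl:
  assumes "i \<noteq> j" "p\<^sup>2 + q\<^sup>2 = 1"
  shows "orthogonal_matrix (plane_refl i j p q)"
proof -
  have "plane_refl i j p q ** plane_refl i j p q = mat 1"
    using assms(2) unfolding vec_eq_iff plane_refl_mult[OF assms(1)]
    by (auto simp: mat_def plane_refl_def assms(1) assms(1)[symmetric] power2_eq_square algebra_simps)
  then show ?thesis
    by (simp add: orthogonal_matrix_def transpose_plane_refl)
qed

text \<open>Conjugation affects only the diagonal entries \<open>i\<close> and \<open>j\<close>. The
  trace of their 2 by 2 block is preserved, so these entries change by opposite amounts.\<close>

lemma inner_plane_refl: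
  fixes B :: "real^'n^'n"
  assumes "i \<noteq> j" "p\<^sup>2 + q\<^sup>2 = 1" "symmetric_mat B"
  defines "R \<equiv> plane_refl i j p q"
  shows "inner (Diag y) (transpose R ** B ** R) =
    inner (Diag y) B + (y$i - y$j) * (q\<^sup>2 * (B$j$j - B$i$i) + 2 * p * q * B$i$j)"
proof -
  let ?M = "transpose R ** B ** R"
  \<comment> \<open>Only the diagonal of \<open>?M\<close> matters and transposition preserves it.
    In this form both factors \<open>R\<close> act on rows, where \<open>plane_refl_mult\<close>
    applies.\<close>
  have "transpose ?M = R ** transpose (R ** B)"
    using assms(3) by (simp add: symmetric_mat_def matrix_transpose_mul R_def transpose_plane_refl matrix_mul_assoc)
  then have M0: "?M $ k $ k = (R ** transpose (R ** B)) $ k $ k" for k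
    using transpose_nth[of ?M k k] by simp
  have M: "?M $ k $ k = (if k = i then p\<^sup>2 * B$i$i + 2*p*q*B$i$j + q\<^sup>2 * B$j$j
      else if k = j then q\<^sup>2 * B$i$i - 2*p*q*B$i$j + p\<^sup>2 * B$j$j else B$k$k)" for k
    unfolding M0 plane_refl_mult[OF assms(1), of p q "transpose (R ** B)", folded R_def]
    using assms(1) symmetric_mat_nth[OF assms(3), of j i]
    by (simp add: transpose_nth plane_refl_mult[OF assms(1), of p q B, folded R_def] power2_eq_square algebra_simps)
  have yM: "y$k * ?M$k$k = y$k * B$k$k
      + ((if k = i then y$i * (q\<^sup>2 * (B$j$j - B$i$i) + 2*p*q*B$i$j) else 0)
      - (if k = j then y$j * (q\<^sup>2 * (B$j$j - B$i$i) + 2*p*q*B$i$j) else 0))" for k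
  proof -
    have p: "p\<^sup>2 = 1 - q\<^sup>2" using assms(2) by simp
    show ?thesis unfolding M p using assms(1) by (auto simp: algebra_simps)
  qed
  have "inner (Diag y) ?M = inner (Diag y) B +
     (y$i * (q\<^sup>2 * (B$j$j - B$i$i) + 2*p*q*B$i$j) - y$j * (q\<^sup>2 * (B$j$j - B$i$i) + 2*p*q*B$i$j))"
    unfolding inner_Diag yM by (simp add: sum.distrib sum_subtractf)
  then show ?thesis by (simp add: algebra_simps)
qed

text \<open>The point (0, 1) gives the sign of \<open>a\<close>. Normalizing (1, s) turns the
  hypothesis into a quadratic inequality in \<open>s\<close>, whose linear part would dominate for
  small \<open>s\<close>.\<close>

lemma circle_quadratic_nonpos:
  fixes a b :: real
  assumes "\<And>p q. p\<^sup>2 + q\<^sup>2 = 1 \<Longrightarrow> q\<^sup>2 * a + p * q * b \<le> 0"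
  shows "a \<le> 0 \<and> b = 0"
proof
  show a: "a \<le> 0" using assms[of 0 1] by simp
  have s: "s\<^sup>2 * a + s * b \<le> 0" for s
  proof -
    define r where "r = sqrt (1 + s\<^sup>2)"
    have r: "r > 0" "r\<^sup>2 = 1 + s\<^sup>2" by (auto simp: r_def add_pos_nonneg)
    have "(1/r)\<^sup>2 + (s/r)\<^sup>2 = 1"
      using r by (simp add: power_divide add_divide_distrib[symmetric] less_imp_neq[symmetric] flip: r(2))
    from assms[OF this] have "(s\<^sup>2 * a + s * b) / r\<^sup>2 \<le> 0"
      by (simp add: power_divide power2_eq_square add_divide_distrib mult_ac)
    then show ?thesis using r(1) by (simp add: divide_le_0_iff)
  qed
  show "b = 0"
  proof (rule ccontr)
    assume b: "b \<noteq> 0"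
    \<comment> \<open>With this \<open>s\<close> the product \<open>s * b\<close> equals
      \<open>s\<^sup>2 * (1 - a)\<close>, so the quadratic takes the positive value
      \<open>s\<^sup>2\<close>.\<close>
    define s where "s = b / (1 - a)"
    have "b = s * (1 - a)" using a by (simp add: s_def)
    then have "s\<^sup>2 * a + s * b = s\<^sup>2" by (simp only:) (simp add: power2_eq_square algebra_simps)
    moreover have "s \<noteq> 0" using a b by (simp add: s_def)
    ultimately have "s\<^sup>2 * a + s * b > 0" by simp
    with s[of s] show False by linarith
  qed
qed

text \<open>Testing maximality with reflections in the plane of \<open>i\<close> and
  \<open>j\<close>, which respect the blocks because the labels agree, leaves a quadratic form on
  the circle. The conclusions later diagonalize, sort, and force commutation.\<close>

lemma maximal_orthogonal_conj:
  fixes B :: "real^'n^'n"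
  assumes B: "symmetric_mat B" and C: "C i = C j" and ij: "i \<noteq> j"
    and max: "\<And>Q. orthogonal_matrix Q \<Longrightarrow> block_mat C Q \<Longrightarrow>
      inner (Diag y) (transpose Q ** B ** Q) \<le> inner (Diag y) B"
  shows "(y$i - y$j) * B$i$j = 0 \<and> (y$i - y$j) * (B$i$i - B$j$j) \<ge> 0"
proof -
  have "(y$i - y$j) * (B$j$j - B$i$i) \<le> 0 \<and> 2 * (y$i - y$j) * B$i$j = 0"
  proof (rule circle_quadratic_nonpos)
    fix p q :: real assume pq: "p\<^sup>2 + q\<^sup>2 = 1"
    have "block_mat C (plane_refl i j p q)"
      unfolding block_mat_def
    proof (intro allI impI)
      fix k l assume "C k \<noteq> C l"
      then have "k \<noteq> l" "\<not> (k = i \<and> l = j)" "\<not> (k = j \<and> l = i)" using C by metis+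
      then show "plane_refl i j p q $ k $ l = 0" by (auto simp: plane_refl_def)
    qed
    from max[OF orthogonal_plane_refl[OF ij pq] this]
    show "q\<^sup>2 * ((y$i - y$j) * (B$j$j - B$i$i)) + p * q * (2 * (y$i - y$j) * B$i$j) \<le> 0"
      unfolding inner_plane_refl[OF ij pq B] by (simp add: algebra_simps)
  qed
  then show ?thesis by (auto simp: algebra_simps)
qed

lemma compact_block_orthogonal: "compact {Q::real^'n^'n. orthogonal_matrix Q \<and> block_mat C Q}"
proof -
  have "bounded {Q::real^'n^'n. orthogonal_matrix Q \<and> block_mat C Q}"
    unfolding bounded_iff
    by (rule exI[of _ "norm (mat 1 :: real^'n^'n)"])
       (use norm_orthogonal_mult(1)[of _ "mat 1 :: real^'n^'n"] in auto)
  moreover have "closed {Q::real^'n^'n. orthogonal_matrix Q \<and> block_mat C Q}"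
  proof -
    have "{Q::real^'n^'n. orthogonal_matrix Q \<and> block_mat C Q} =
      {Q. transpose Q ** Q = mat 1} \<inter> {Q. \<forall>k l. C k \<noteq> C l \<longrightarrow> Q $ k $ l = 0}"
      by (auto simp: orthogonal_matrix block_mat_def)
    moreover have "closed {Q::real^'n^'n. transpose Q ** Q = mat 1}"
      by (intro closed_Collect_eq continuous_on_const
          bounded_bilinear.continuous_on[OF bounded_bilinear_matrix_mult]
          linear_continuous_on bounded_linear_transpose continuous_on_id)
    moreover have "closed {Q::real^'n^'n. \<forall>k l. C k \<noteq> C l \<longrightarrow> Q $ k $ l = 0}"
      by (intro closed_Collect_all closed_Collect_imp closed_Collect_eq open_Collect_const
          continuous_intros)
    ultimately show ?thesis by (simp only: closed_Int)
  qed
  ultimately show ?thesis by (simp add: compact_eq_bounded_closed)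
qed

text \<open>Variational proof: maximize the pairing of a strictly decreasing diagonal with the
  conjugates of \<open>B\<close> over the compact group of block orthogonal matrices. At a maximizer
  the optimality conditions kill off-diagonal entries inside blocks and sort the diagonal
  there.\<close>

lemma block_spectral:
  fixes B :: "real^('n::{finite,linorder})^('n::{finite,linorder})"
  assumes B: "symmetric_mat B" and BC: "block_mat C B"
  obtains Q h where "orthogonal_matrix Q" "block_mat C Q" "B = Q ** Diag h ** transpose Q"
    "\<And>i j. i \<le> j \<Longrightarrow> C i = C j \<Longrightarrow> h $ j \<le> h $ i"
proof -
  let ?S = "{Q::real^('n::{finite,linorder})^('n::{finite,linorder}). orthogonal_matrix Q \<and> block_mat C Q}"
  \<comment> \<open>Counting the indices from \<open>i\<close> onwards yields a strictly decreasing
    vector on an abstract finite linear order.\<close>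
  define d :: "real^('n::{finite,linorder})" where "d = (\<chi> i. real (card {k. i \<le> k}))"
  have d: "d $ j < d $ i" if "i < j" for i j
  proof -
    have "{k. j \<le> k} \<subseteq> {k. i \<le> k}" "i \<in> {k. i \<le> k}" "i \<notin> {k. j \<le> k}" using that by auto
    then have "{k. j \<le> k} \<subset> {k. i \<le> k}" by blast
    then have "card {k. j \<le> k} < card {k. i \<le> k}" by (rule psubset_card_mono[OF finite])
    then show ?thesis by (simp add: d_def)
  qed
  have "mat 1 \<in> ?S"
    using orthogonal_matrix_id by (simp add: block_mat_def) (auto simp: mat_def)
  moreover have "continuous_on ?S (\<lambda>Q. inner (Diag d) (transpose Q ** B ** Q))"
    by (intro continuous_intros bounded_bilinear.continuous_on[OF bounded_bilinear_matrix_mult]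
          linear_continuous_on bounded_linear_transpose)
  ultimately obtain Q where Q: "Q \<in> ?S" and
    max: "\<And>R. R \<in> ?S \<Longrightarrow> inner (Diag d) (transpose R ** B ** R) \<le> inner (Diag d) (transpose Q ** B ** Q)"
    using continuous_attains_sup[OF compact_block_orthogonal[of C]] by blast
  define M where "M = transpose Q ** B ** Q"
  have M: "symmetric_mat M" "block_mat C M"
    using symmetric_mat_conj[OF B, of "transpose Q"] Q
    by (auto simp: M_def intro!: block_mat_mult BC block_mat_transpose)
  \<comment> \<open>As \<open>Q ** R\<close> is again admissible, maximality of \<open>Q\<close>
    becomes maximality of the identity for \<open>M\<close>.\<close>
  have max': "inner (Diag d) (transpose R ** M ** R) \<le> inner (Diag d) M"
    if "orthogonal_matrix R" "block_mat C R" for R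
    using max[of "Q ** R"] Q that
    by (simp add: M_def matrix_transpose_mul matrix_mul_assoc orthogonal_matrix_mul block_mat_mult)
  have off: "M $ i $ j = 0" if "i \<noteq> j" for i j
  proof (cases "C i = C j")
    case True
    have "d $ i \<noteq> d $ j" using that d by (metis less_irrefl linorder_neq_iff)
    then show ?thesis using maximal_orthogonal_conj[OF M(1) True that max'] by simp
  next
    case False
    then show ?thesis using M(2) by (auto simp: block_mat_def)
  qed
  define h where "h = (\<chi> i. M $ i $ i)"
  have "M = Diag h"
    using off by (auto simp: vec_eq_iff Diag_nth h_def)
  moreover have "Q ** M ** transpose Q = B"
    using orthogonal_matrixD[of Q] Q by (simp add: M_def matrix_mul_assoc)
  ultimately have "B = Q ** Diag h ** transpose Q" by simp
  moreover have "h $ j \<le> h $ i" if "i \<le> j" "C i = C j" for i j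
  proof (cases "i = j")
    case False
    then have "d $ j < d $ i" using that d by simp
    then show ?thesis
      using maximal_orthogonal_conj[OF M(1) that(2) False max']
      by (simp add: h_def zero_le_mult_iff)
  qed simp
  ultimately show thesis using Q that by auto
qed

section \<open>Ordered eigenvalues and Fan's inequality\<close>

text \<open>Induction on the number of distinct values of \<open>y\<close>: lowering the top value
  to the next one subtracts a positive multiple of the indicator of an initial segment. Both sides
  are linear in \<open>y\<close>, so only that indicator remains to be checked.\<close>

lemma sum_doubly_stochastic_le:
  fixes S :: "'n::{finite,linorder} \<Rightarrow> 'n \<Rightarrow> real" and y z :: "'n \<Rightarrow> real"
  assumes S: "\<And>i j. 0 \<le> S i j" and row: "\<And>i. (\<Sum>j\<in>UNIV. S i j) = 1"
    and col: "\<And>j. (\<Sum>i\<in>UNIV. S i j) = 1"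
    and y: "antimono y" and z: "antimono z"
  shows "(\<Sum>i\<in>UNIV. \<Sum>j\<in>UNIV. S i j * y i * z j) \<le> (\<Sum>i\<in>UNIV. y i * z i)"
  using y
proof (induction "card (range y)" arbitrary: y rule: less_induct)
  case less
  let ?F = "\<lambda>y. (\<Sum>i\<in>UNIV. \<Sum>j\<in>UNIV. S i j * y i * z j)" and ?G = "\<lambda>y. (\<Sum>i\<in>UNIV. y i * z i)"
  define m where "m = Max (range y)"
  define D where "D = {i. y i = m}"
  have m: "y i \<le> m" for i unfolding m_def by simp
  have down: "i \<in> D" if "i \<le> j" "j \<in> D" for i j
    using that m[of i] antimonoD[OF less.prems that(1)] by (simp add: D_def)
  have "D \<noteq> {}"
  proof -
    have "m \<in> range y" unfolding m_def by (rule Max_in) auto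
    then show ?thesis by (auto simp: D_def)
  qed
  show ?case
  proof (cases "D = UNIV")
    case True
    then have y: "y = (\<lambda>_. m)" by (auto simp: D_def)
    have "?F y = m * (\<Sum>j\<in>UNIV. (\<Sum>i\<in>UNIV. S i j) * z j)"
      unfolding y by (subst sum.swap) (simp add: sum_distrib_left sum_distrib_right mult_ac)
    also have "\<dots> = ?G y" by (simp add: col y sum_distrib_left)
    finally show ?thesis by simp
  next
    case False
    \<comment> \<open>The second largest value of \<open>y\<close>; replacing the top value by it
      removes one element from the range.\<close>
    define m' where "m' = Max (y ` (- D))"
    have ne: "y ` (- D) \<noteq> {}" using False by auto
    have m'_in: "m' \<in> y ` (- D)" unfolding m'_def by (rule Max_in) (use ne in auto)
    have m': "y i \<le> m'" if "i \<notin> D" for i unfolding m'_def using that by simp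
    have "m' < m" using m'_in m unfolding D_def by (force simp: order.order_iff_strict)
    define y' where "y' = (\<lambda>i. if i \<in> D then m' else y i)"
    have "range y' \<subseteq> y ` (- D)" using m'_in by (auto simp: y'_def)
    moreover have "m \<in> range y" "m \<notin> y ` (- D)" using \<open>D \<noteq> {}\<close> by (auto simp: D_def)
    then have "y ` (- D) \<subset> range y" by blast
    ultimately have "card (range y') < card (range y)" by (meson finite finite_imageI psubset_card_mono subset_psubset_trans)
    moreover have "antimono y'"
      using antimonoD[OF less.prems] down m' by (auto simp: antimono_def y'_def)
    ultimately have IH: "?F y' \<le> ?G y'" by (rule less.hyps)
    define e where "e = (\<lambda>i. if i \<in> D then 1 else 0 :: real)"
    define s where "s = (\<lambda>j. \<Sum>i\<in>UNIV. S i j * e i)"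
    have yy: "y i = y' i + (m - m') * e i" for i by (auto simp: y'_def e_def D_def)
    \<comment> \<open>\<open>z k\<close> is the least value of \<open>z\<close> on \<open>D\<close>.
      Since \<open>s\<close> and \<open>e\<close> have the same total, \<open>z\<close> may be
      shifted by it, after which every summand of \<open>(s - e) * z\<close> is nonpositive.\<close>
    obtain k where k: "k \<in> D" "\<And>i. i \<in> D \<Longrightarrow> z k \<le> z i"
    proof -
      have "Min (z ` D) \<in> z ` D" by (rule Min_in) (use \<open>D \<noteq> {}\<close> in auto)
      then obtain k where "k \<in> D" "z k = Min (z ` D)" by auto
      then show thesis using that[of k] by simp
    qed
    have s01: "0 \<le> s j" "s j \<le> 1" for j
      using S sum_mono[of UNIV "\<lambda>i. S i j * e i" "\<lambda>i. S i j"] col[of j]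
      by (auto simp: s_def e_def intro!: sum_nonneg)
    have "(s j - e j) * (z j - z k) \<le> 0" for j
    proof (cases "j \<in> D")
      case True
      then show ?thesis using s01[of j] k(2)[OF True] by (simp add: e_def mult_le_0_iff)
    next
      case False
      then have "k \<le> j" using down[of j k] k(1) by force
      then show ?thesis using s01[of j] antimonoD[OF z] False by (simp add: e_def mult_le_0_iff)
    qed
    then have "(\<Sum>j\<in>UNIV. (s j - e j) * (z j - z k)) \<le> 0" by (simp add: sum_nonpos)
    moreover have "sum s UNIV = sum e UNIV"
      unfolding s_def by (subst sum.swap) (simp add: row flip: sum_distrib_right)
    ultimately have "(\<Sum>j\<in>UNIV. s j * z j) \<le> ?G e"
      by (simp add: algebra_simps sum.distrib sum_subtractf flip: sum_distrib_right)
    moreover have "?F e = (\<Sum>j\<in>UNIV. s j * z j)"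
      unfolding s_def by (subst sum.swap) (simp add: sum_distrib_right)
    ultimately have "?F e \<le> ?G e" by simp
    then have "(m - m') * ?F e \<le> (m - m') * ?G e" using \<open>m' < m\<close> by (intro mult_left_mono) auto
    moreover have "?F y = ?F y' + (m - m') * ?F e" "?G y = ?G y' + (m - m') * ?G e"
      unfolding yy sum_distrib_left by (simp_all add: distrib_left distrib_right sum.distrib mult_ac)
    ultimately show ?thesis using IH by linarith
  qed
qed

text \<open>The squared entries of an orthogonal matrix form a doubly stochastic matrix.\<close>

lemma fan_Diag:
  assumes y: "nonincreasing_vec y" and z: "nonincreasing_vec z" and Q: "orthogonal_matrix Q"
  shows "inner (Diag y) (Q ** Diag z ** transpose Q) \<le> inner y z"
proof -
  have "(Q ** transpose Q) $ i $ i = 1" "(transpose Q ** Q) $ i $ i = 1" for i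
    by (simp_all add: orthogonal_matrixD[OF Q]) (simp_all add: mat_def)
  then have r: "(\<Sum>j\<in>UNIV. (Q $ i $ j)\<^sup>2) = 1" "(\<Sum>j\<in>UNIV. (Q $ j $ i)\<^sup>2) = 1" for i
    by (simp_all add: matrix_mult_nth transpose_nth power2_eq_square)
  have "(\<Sum>i\<in>UNIV. \<Sum>j\<in>UNIV. (Q $ i $ j)\<^sup>2 * y $ i * z $ j) \<le> (\<Sum>i\<in>UNIV. y $ i * z $ i)"
    by (rule sum_doubly_stochastic_le) (use r y z in \<open>auto simp: antimono_def nonincreasing_vec_def\<close>)
  then show ?thesis
    unfolding inner_Diag conj_Diag_nth_diag by (simp add: inner_vec_def sum_distrib_left mult_ac)
qed

text \<open>For two sorted diagonalizations, Fan's inequality in both directions bounds each squared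
  norm by the common inner product, so the squared distance is at most zero. This makes the definite
  description in \<open>eigs\<close> usable.\<close>

lemma eigs_eqI:
  assumes x: "nonincreasing_vec x" and U: "orthogonal_matrix U" and X: "X = U ** Diag x ** transpose U"
  shows "eigs X = x"
  unfolding eigs_def
proof (rule the_equality)
  show "nonincreasing_vec x \<and> (\<exists>U. orthogonal_matrix U \<and> X = U ** Diag x ** transpose U)"
    using assms by blast
next
  fix x' assume "nonincreasing_vec x' \<and> (\<exists>U. orthogonal_matrix U \<and> X = U ** Diag x' ** transpose U)"
  then obtain V where x': "nonincreasing_vec x'" and V: "orthogonal_matrix V"
    and X': "X = V ** Diag x' ** transpose V" by blast
  have "inner a a \<le> inner a b"
    if "nonincreasing_vec a" "nonincreasing_vec b" "orthogonal_matrix P" "orthogonal_matrix R"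
      "P ** Diag a ** transpose P = R ** Diag b ** transpose R" for a b P R
  proof -
    have "Diag a = transpose P ** (P ** Diag a ** transpose P) ** P"
      by (simp add: matrix_mul_assoc orthogonal_matrixD[OF that(3)])
    also have "\<dots> = (transpose P ** R) ** Diag b ** transpose (transpose P ** R)"
      by (simp add: that(5) matrix_transpose_mul matrix_mul_assoc)
    finally have "inner (Diag a) (Diag a) \<le> inner a b"
      using fan_Diag[OF that(1,2), of "transpose P ** R"] that(3,4) by (simp add: orthogonal_matrix_mul)
    then show ?thesis by (simp add: inner_Diag_Diag)
  qed
  from this[OF x x' U V] this[OF x' x V U] have "inner (x' - x) (x' - x) \<le> 0"
    using X X' by (simp add: inner_diff inner_commute)
  then have "inner (x' - x) (x' - x) = 0" by (intro antisym inner_ge_zero)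
  then show "x' = x" by simp
qed

lemma eigs_Diag: "nonincreasing_vec x \<Longrightarrow> eigs (Diag x) = x"
  by (rule eigs_eqI[of _ "mat 1"]) (simp_all add: orthogonal_matrix_id)

lemma orth_diag_nonempty:
  assumes "symmetric_mat X"
  shows "nonincreasing_vec (eigs X)" "orth_diag X \<noteq> {}"
proof -
  \<comment> \<open>A constant label puts all indices into one block, giving the ordinary spectral
    theorem with sorted eigenvalues.\<close>
  obtain Q h where Q: "orthogonal_matrix Q" "X = Q ** Diag h ** transpose Q"
    "\<And>i j. i \<le> j \<Longrightarrow> h $ j \<le> h $ i"
    using block_spectral[OF assms, of "\<lambda>_. ()"] by (auto simp: block_mat_def)
  then have h: "nonincreasing_vec h" by (simp add: nonincreasing_vec_def)
  with Q have "eigs X = h" by (intro eigs_eqI)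
  then show "nonincreasing_vec (eigs X)" "orth_diag X \<noteq> {}"
    using Q h by (auto simp: orth_diag_def)
qed

lemma orth_diagD:
  assumes "U \<in> orth_diag X"
  shows "orthogonal_matrix U" "X = U ** Diag (eigs X) ** transpose U"
    "transpose U ** X ** U = Diag (eigs X)"
proof -
  show U: "orthogonal_matrix U" and X: "X = U ** Diag (eigs X) ** transpose U"
    using assms by (auto simp: orth_diag_def)
  have "transpose U ** (U ** Diag (eigs X) ** transpose U) ** U = Diag (eigs X)"
    by (simp add: matrix_mul_assoc orthogonal_matrixD[OF U])
  then show "transpose U ** X ** U = Diag (eigs X)" using X by simp
qed

lemma eigs_conj:
  assumes A: "symmetric_mat A" and Q: "orthogonal_matrix Q"
  shows "eigs (Q ** A ** transpose Q) = eigs A"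
proof -
  obtain U where U: "U \<in> orth_diag A" using orth_diag_nonempty(2)[OF A] by blast
  have "Q ** A ** transpose Q = (Q ** U) ** Diag (eigs A) ** transpose (Q ** U)"
    by (subst orth_diagD(2)[OF U]) (simp add: matrix_transpose_mul matrix_mul_assoc)
  then show ?thesis
    by (intro eigs_eqI[OF orth_diag_nonempty(1)[OF A], of "Q ** U"] orthogonal_matrix_mul Q orth_diagD(1)[OF U])
qed

lemma fan_inequality:
  assumes y: "nonincreasing_vec y" and A: "symmetric_mat A" and Q: "orthogonal_matrix Q"
  shows "inner (Q ** Diag y ** transpose Q) A \<le> inner y (eigs A)"
proof -
  obtain U where U: "U \<in> orth_diag A" using orth_diag_nonempty(2)[OF A] by blast
  have "inner (Q ** Diag y ** transpose Q) A = inner (Diag y) (transpose Q ** A ** Q)"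
    by (rule inner_conj)
  also have "transpose Q ** A ** Q = (transpose Q ** U) ** Diag (eigs A) ** transpose (transpose Q ** U)"
    by (subst orth_diagD(2)[OF U]) (simp add: matrix_transpose_mul matrix_mul_assoc)
  also have "inner (Diag y) \<dots> \<le> inner y (eigs A)"
    by (intro fan_Diag y orth_diag_nonempty(1)[OF A] orthogonal_matrix_mul)
       (simp_all add: Q orth_diagD(1)[OF U])
  finally show ?thesis .
qed

lemma norm_eigs:
  assumes "symmetric_mat A"
  shows "norm (eigs A) = norm A"
proof -
  obtain U where U: "U \<in> orth_diag A" using orth_diag_nonempty(2)[OF assms] by blast
  show ?thesis
    by (subst (2) orth_diagD(2)[OF U])
       (simp add: norm_orthogonal_mult orth_diagD(1)[OF U] norm_Diag)
qed

text \<open>In the expanded squared distances the pure squares agree on both sides, and Fan's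
  inequality compares the cross terms.\<close>

lemma norm_eigs_diff_le:
  assumes A: "symmetric_mat A" and B: "symmetric_mat B"
  shows "norm (eigs A - eigs B) \<le> norm (A - B)"
proof -
  obtain U where U: "U \<in> orth_diag A" using orth_diag_nonempty(2)[OF A] by blast
  have "inner A B \<le> inner (eigs A) (eigs B)"
    using fan_inequality[OF orth_diag_nonempty(1)[OF A] B orth_diagD(1)[OF U]] orth_diagD(2)[OF U] by simp
  moreover have "inner (eigs A) (eigs A) = inner A A" "inner (eigs B) (eigs B) = inner B B"
    using norm_eigs[OF A] norm_eigs[OF B] by (simp_all flip: power2_norm_eq_inner)
  ultimately have "inner (eigs A - eigs B) (eigs A - eigs B) \<le> inner (A - B) (A - B)"
    by (simp add: inner_diff inner_commute)
  then show ?thesis by (simp add: norm_eq_sqrt_inner)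
qed

section \<open>Second-order expansion of orthogonal conjugation\<close>

text \<open>An algebraic substitute for the exponential of \<open>t *\<^sub>R A\<close>: for skew
  \<open>A\<close> it is orthogonal and has the same second-order expansion, with a remainder in
  closed form.\<close>

definition cayley :: "real^'n^'n \<Rightarrow> real \<Rightarrow> real^'n^'n" where
  "cayley A t = (mat 1 + (t/2) *\<^sub>R A) ** matrix_inv (mat 1 - (t/2) *\<^sub>R A)"

text \<open>For skew \<open>A\<close> the form \<open>inner x (A *v x)\<close> vanishes, so the
  denominator has trivial kernel. Numerator and denominator are transposes of each other and
  commute, whence orthogonality; multiplying by the denominator gives the fixed-point
  equation.\<close>

lemma cayley:
  fixes A :: "real^'n^'n"
  assumes A: "transpose A = - A"
  shows orthogonal_cayley: "orthogonal_matrix (cayley A t)"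
    and cayley_eq: "cayley A t = mat 1 + (t/2) *\<^sub>R A + (t/2) *\<^sub>R (cayley A t ** A)"
proof -
  define M where "M = mat 1 - (t/2) *\<^sub>R A"
  define N where "N = mat 1 + (t/2) *\<^sub>R A"
  define W where "W = matrix_inv M"
  have "x = 0" if "M *v x = 0" for x
  proof -
    have x: "x = (t/2) *\<^sub>R (A *v x)"
      using that by (simp add: M_def matrix_vector_mult_diff_rdistrib scaleR_matrix_vector_assoc)
    have "inner x (A *v x) = inner (transpose A *v x) x"
      by (simp add: dot_lmul_matrix)
    also have "\<dots> = - inner x (A *v x)"
      unfolding A by (simp add: inner_commute matrix_vector_mult_def inner_vec_def sum_negf)
    finally have "inner x (A *v x) = 0" by simp
    then have "inner x x = 0" by (subst (2) x) simp
    then show "x = 0" by simp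
  qed
  then have "\<exists>B. B ** M = mat 1" by (simp add: matrix_left_invertible_ker)
  then have "invertible M" by (metis invertible_def matrix_left_right_inverse)
  then have W: "M ** W = mat 1" "W ** M = mat 1"
    unfolding W_def matrix_inv_def invertible_def by (metis (mono_tags, lifting) someI_ex)+
  have O: "cayley A t = N ** W" by (simp add: cayley_def M_def N_def W_def)
  have T: "transpose M = N" "transpose N = M"
    by (simp_all add: M_def N_def transpose_add transpose_diff transpose_scalar A)
  have comm: "M ** N = N ** M"
    by (simp add: M_def N_def matrix_mult_bilinear algebra_simps)
  have "transpose (N ** W) ** (N ** W) = transpose W ** (M ** N) ** W"
    by (simp add: matrix_transpose_mul T matrix_mul_assoc)
  also have "\<dots> = transpose (M ** W) ** (M ** W)"
    unfolding comm by (simp add: matrix_transpose_mul T matrix_mul_assoc)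
  finally show "orthogonal_matrix (cayley A t)" by (simp add: O W orthogonal_matrix)
  have "cayley A t ** M = N" by (simp add: O W flip: matrix_mul_assoc)
  then show "cayley A t = mat 1 + (t/2) *\<^sub>R A + (t/2) *\<^sub>R (cayley A t ** A)"
    by (simp add: M_def N_def matrix_mult_bilinear algebra_simps)
qed

definition cayley_rem :: "real^'n^'n \<Rightarrow> real \<Rightarrow> real^'n^'n" where
  "cayley_rem A t = (1/4) *\<^sub>R (A ** A + cayley A t ** A ** A)"

text \<open>The exact coefficient of \<open>t\<^sup>2\<close> in the conjugation of \<open>Z\<close>
  by the Cayley transform of a skew \<open>A\<close>; terms of higher order are kept in it as
  well.\<close>

definition conj_rem :: "real^'n^'n \<Rightarrow> real \<Rightarrow> real^'n^'n \<Rightarrow> real^'n^'n" where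
  "conj_rem A t Z = (let D = cayley_rem A t; D' = transpose D in
     D ** Z + Z ** D' - A ** Z ** A + t *\<^sub>R (A ** Z ** D' - D ** Z ** A) + t\<^sup>2 *\<^sub>R (D ** Z ** D'))"

text \<open>The fixed-point equation \<open>cayley_eq\<close> is substituted into itself
  once.\<close>

lemma cayley_expansion:
  fixes A :: "real^'n^'n"
  assumes A: "transpose A = - A"
  shows "cayley A t = mat 1 + t *\<^sub>R A + t\<^sup>2 *\<^sub>R cayley_rem A t"
proof -
  have "cayley A t ** A = A + (t/2) *\<^sub>R (A ** A + cayley A t ** A ** A)"
    by (subst cayley_eq[OF A]) (simp add: matrix_mult_bilinear scaleR_add_right)
  then have "cayley A t = mat 1 + (t/2) *\<^sub>R A + (t/2) *\<^sub>R (A + (t/2) *\<^sub>R (A ** A + cayley A t ** A ** A))"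
    using cayley_eq[OF A, of t] by metis
  also have "\<dots> = mat 1 + (t/2 + t/2) *\<^sub>R A + (t/2 * (t/2)) *\<^sub>R (A ** A + cayley A t ** A ** A)"
    by (simp only: scaleR_add_right scaleR_scaleR scaleR_add_left add_ac)
  finally show ?thesis by (simp add: cayley_rem_def power2_eq_square)
qed

lemma conj_expansion:
  fixes A Z :: "real^'n^'n"
  assumes A: "transpose A = - A"
  shows "cayley A t ** Z ** transpose (cayley A t) = Z + t *\<^sub>R (A ** Z - Z ** A) + t\<^sup>2 *\<^sub>R conj_rem A t Z"
proof -
  define D where "D = cayley_rem A t"
  have *: "cayley A t = mat 1 + t *\<^sub>R A + t\<^sup>2 *\<^sub>R D"
    "transpose (cayley A t) = mat 1 - t *\<^sub>R A + t\<^sup>2 *\<^sub>R transpose D"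
    by (simp_all add: D_def cayley_expansion[OF A] transpose_add transpose_scalar A)
  show ?thesis
    unfolding *(2) unfolding *(1) conj_rem_def Let_def D_def[symmetric]
    by (simp add: matrix_mult_bilinear matrix_mul_assoc scaleR_add_right scaleR_diff_right
        power2_eq_square algebra_simps)
qed

lemma norm_cayley:
  fixes A B :: "real^'n^'n"
  assumes "transpose A = - A"
  shows "norm (cayley A t ** B) = norm B"
  by (rule norm_orthogonal_mult(1)[OF orthogonal_cayley[OF assms]])

text \<open>The orthogonal factor preserves norms, so the fixed-point equation bounds the distance
  to the identity by the norm of \<open>t x *\<^sub>R A\<close>.\<close>

lemma tendsto_cayley_0:
  fixes A :: "real^'n^'n"
  assumes A: "transpose A = - A" and t: "(t \<longlongrightarrow> 0) F"
  shows "((\<lambda>x. cayley A (t x)) \<longlongrightarrow> mat 1) F"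
proof -
  have lim: "((\<lambda>x. t x *\<^sub>R A) \<longlongrightarrow> 0) F" by (rule tendsto_eq_intros t refl | simp)+
  have le: "norm (cayley A (t x) - mat 1) \<le> norm (t x *\<^sub>R A) * 1" for x
  proof -
    have "cayley A (t x) - mat 1 = (t x/2) *\<^sub>R A + (t x/2) *\<^sub>R (cayley A (t x) ** A)"
      using cayley_eq[OF A, of "t x"] by (simp add: algebra_simps)
    also have "norm \<dots> \<le> norm ((t x/2) *\<^sub>R A) + norm ((t x/2) *\<^sub>R (cayley A (t x) ** A))"
      by (rule norm_triangle_ineq)
    finally show ?thesis by (simp add: norm_cayley[OF A] mult.commute)
  qed
  have "((\<lambda>x. cayley A (t x) - mat 1) \<longlongrightarrow> 0) F"
    by (rule tendsto_0_le[OF lim always_eventually[OF allI[OF le]]])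
  then show ?thesis by (simp add: Lim_null[symmetric])
qed

text \<open>The limit is half the double commutator [A, [A, Z]], the quadratic term of conjugation
  by an exponential.\<close>

lemma tendsto_conj_rem:
  fixes A Z :: "real^'n^'n"
  assumes A: "transpose A = - A" and t: "(t \<longlongrightarrow> 0) F" and z: "(z \<longlongrightarrow> Z) F"
  shows "((\<lambda>x. conj_rem A (t x) (z x)) \<longlongrightarrow> (1/2) *\<^sub>R (A ** A ** Z + Z ** A ** A) - A ** Z ** A) F"
proof -
  have "((\<lambda>x. cayley_rem A (t x)) \<longlongrightarrow> (1/4) *\<^sub>R (A ** A + mat 1 ** A ** A)) F"
    unfolding cayley_rem_def
    by (intro tendsto_intros tendsto_matrix_mult tendsto_cayley_0 A t)
  also have "(1/4) *\<^sub>R (A ** A + mat 1 ** A ** A) = (1/2) *\<^sub>R (A ** A)"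
    by (simp flip: scaleR_2)
  finally have D: "((\<lambda>x. cayley_rem A (t x)) \<longlongrightarrow> (1/2) *\<^sub>R (A ** A)) F" .
  have T: "transpose ((1/2) *\<^sub>R (A ** A)) = (1/2) *\<^sub>R (A ** A)"
    by (simp add: transpose_scalar matrix_transpose_mul A matrix_mult_bilinear)
  let ?D = "(1/2) *\<^sub>R (A ** A)"
  have "((\<lambda>x. conj_rem A (t x) (z x)) \<longlongrightarrow> ?D ** Z + Z ** transpose ?D - A ** Z ** A
      + 0 *\<^sub>R (A ** Z ** transpose ?D - ?D ** Z ** A) + 0\<^sup>2 *\<^sub>R (?D ** Z ** transpose ?D)) F"
    unfolding conj_rem_def Let_def
    by (intro tendsto_intros tendsto_matrix_mult tendsto_transpose D A t z)
  then show ?thesis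
    unfolding T by (simp add: matrix_mult_bilinear scaleR_add_right matrix_mul_assoc)
qed

section \<open>Paths of conjugates tangent to a given direction, and their second-order term\<close>

definition block_part :: "('n \<Rightarrow> 'c) \<Rightarrow> real^'n^'n \<Rightarrow> real^'n^'n" where
  "block_part C H = (\<chi> i j. if C i = C j then H $ i $ j else 0)"

text \<open>Division by zero makes the entries inside the blocks of equal eigenvalues vanish.\<close>
definition off_gen :: "real^'n \<Rightarrow> real^'n^'n \<Rightarrow> real^'n^'n" where
  "off_gen x H = (\<chi> i j. H $ i $ j / (x $ j - x $ i))"

lemma transpose_off_gen:
  assumes "symmetric_mat H" shows "transpose (off_gen x H) = - off_gen x H"
proof -
  have "H $ j $ i / (x $ i - x $ j) = - (H $ i $ j / (x $ j - x $ i))" for i j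
    using symmetric_mat_nth[OF assms, of j i] minus_divide_right[of "H $ i $ j" "x $ j - x $ i"] by simp
  then show ?thesis
    unfolding vec_eq_iff transpose_nth off_gen_def vector_uminus_component vec_lambda_beta by blast
qed

text \<open>The commutator of any matrix with \<open>Diag x\<close> multiplies entry (i, j) by
  \<open>x $ j - x $ i\<close>; \<open>off_gen\<close> divides by exactly this factor wherever it is
  nonzero.\<close>

lemma commutator_off_gen:
  "off_gen x H ** Diag x - Diag x ** off_gen x H = H - block_part (($) x) H"
proof -
  have "H $ i $ j / (x $ j - x $ i) * x $ j - x $ i * (H $ i $ j / (x $ j - x $ i)) =
      H $ i $ j - (if x $ i = x $ j then H $ i $ j else 0)" for i j
  proof (cases "x $ i = x $ j")
    case False
    then have "H $ i $ j / (x $ j - x $ i) * (x $ j - x $ i) = H $ i $ j" by simp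
    moreover have "c * (x $ j - x $ i) = c * x $ j - x $ i * c" for c :: real
      by (simp add: right_diff_distrib mult.commute)
    ultimately have "H $ i $ j / (x $ j - x $ i) * x $ j - x $ i * (H $ i $ j / (x $ j - x $ i)) = H $ i $ j"
      by metis
    with False show ?thesis by (simp only: if_False diff_0_right)
  qed simp
  then show ?thesis
    by (simp add: vec_eq_iff mult_Diag_nth Diag_mult_nth off_gen_def block_part_def)
qed

lemma block_mat_block_part: "block_mat C (block_part C H)"
  by (simp add: block_mat_def block_part_def)

lemma symmetric_mat_block_part: "symmetric_mat H \<Longrightarrow> symmetric_mat (block_part C H)"
  using symmetric_mat_nth[of H]
  unfolding symmetric_mat_def[of "block_part C H"] vec_eq_iff transpose_nth by (simp add: block_part_def)

lemma inner_Diag_block_part: "inner (Diag y) (block_part C H) = inner (Diag y) H"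
  by (simp add: inner_Diag block_part_def)

text \<open>The curvature term of the theorem in an eigenbasis. Summands with
  \<open>x $ i = x $ k\<close> vanish because division by zero gives zero, in agreement with the
  Moore-Penrose inverse.\<close>

definition curvature :: "real^'n \<Rightarrow> real^'n \<Rightarrow> real^'n^'n \<Rightarrow> real" where
  "curvature x y H = 2 * (\<Sum>i\<in>UNIV. \<Sum>k\<in>UNIV. y $ i * ((H $ i $ k)\<^sup>2 / (x $ i - x $ k)))"

text \<open>\<open>A\<close> lives outside the blocks and \<open>B\<close> inside, so their
  commutator has zero diagonal. The rest has diagonal entries summing
  \<open>(x $ i - x $ k) * (A $ i $ k * A $ k $ i)\<close> over \<open>k\<close>, and skewness of
  \<open>A\<close> turns these into the curvature summands.\<close>

lemma inner_second_order_off_gen: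
  fixes H :: "real^'n^'n" and x y :: "real^'n"
  assumes H: "symmetric_mat H"
  defines "A \<equiv> off_gen x H" and "B \<equiv> block_part (($) x) H"
  shows "2 * inner (Diag y) ((1/2) *\<^sub>R (A ** A ** Diag x + Diag x ** A ** A) - A ** Diag x ** A + (A ** B - B ** A))
    = - curvature x y H"
proof -
  have skew: "A $ k $ i = - A $ i $ k" for i k
    using transpose_nth[of A i k] transpose_off_gen[OF H, of x] by (simp add: A_def)
  have AB: "(A ** B) $ i $ i = 0" "(B ** A) $ i $ i = 0" for i
    unfolding matrix_mult_nth A_def B_def off_gen_def block_part_def
    by (auto intro!: sum.neutral)
  have "inner (Diag y) ((1/2) *\<^sub>R (A ** A ** Diag x + Diag x ** A ** A) - A ** Diag x ** A + (A ** B - B ** A))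
    = (\<Sum>i\<in>UNIV. y $ i * (x $ i * (A ** A) $ i $ i - (A ** (Diag x ** A)) $ i $ i))"
    unfolding inner_Diag
    by (simp add: AB mult_Diag_nth Diag_mult_nth flip: matrix_mul_assoc)
       (simp add: mult_Diag_nth Diag_mult_nth matrix_mul_assoc mult.commute)
  also have "\<dots> = (\<Sum>i\<in>UNIV. y $ i * (\<Sum>k\<in>UNIV. (x $ i - x $ k) * (A $ i $ k * A $ k $ i)))"
    unfolding matrix_mult_nth[of A] Diag_mult_nth
    by (intro sum.cong refl) (simp add: sum_distrib_left algebra_simps sum_subtractf)
  also have "\<dots> = - (\<Sum>i\<in>UNIV. \<Sum>k\<in>UNIV. y $ i * ((H $ i $ k)\<^sup>2 / (x $ i - x $ k)))"
  proof -
    have "(x $ i - x $ k) * (A $ i $ k * A $ k $ i) = - ((H $ i $ k)\<^sup>2 / (x $ i - x $ k))" for i k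
    proof -
      have "A $ k $ i = - A $ i $ k" by (rule skew)
      moreover have "A $ i $ k = - (H $ i $ k / (x $ i - x $ k))"
        unfolding A_def off_gen_def using minus_divide_right[of "H $ i $ k" "x $ i - x $ k"] by simp
      ultimately show ?thesis by (simp add: power2_eq_square)
    qed
    then show ?thesis by (simp add: sum_distrib_left sum_negf)
  qed
  finally show ?thesis by (simp add: curvature_def)
qed

definition path_rem :: "real^'n \<Rightarrow> real^'n^'n \<Rightarrow> real \<Rightarrow> real^'n^'n \<Rightarrow> real^'n^'n" where
  "path_rem x H t Z = (let A = off_gen x H in
     conj_rem A t (Diag x) + (A ** Z - Z ** A) + t *\<^sub>R conj_rem A t Z)"

text \<open>At first order, conjugating \<open>Diag x\<close> supplies the part of \<open>H\<close>
  outside the blocks, while \<open>Z\<close> is carried along. With \<open>Z\<close> near the block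
  part of \<open>H\<close> the path has velocity near \<open>H\<close>.\<close>

lemma path_expansion:
  fixes x :: "real^'n" and H Z :: "real^'n^'n" and t :: real
  assumes H: "symmetric_mat H"
  defines "Q \<equiv> cayley (off_gen x H) t"
  shows "Q ** (Diag x + t *\<^sub>R Z) ** transpose Q =
    Diag x + t *\<^sub>R (Z + H - block_part (($) x) H) + t\<^sup>2 *\<^sub>R path_rem x H t Z"
proof -
  note A = transpose_off_gen[OF H, of x]
  have "Q ** (Diag x + t *\<^sub>R Z) ** transpose Q
     = Q ** Diag x ** transpose Q + t *\<^sub>R (Q ** Z ** transpose Q)"
    by (simp add: matrix_mult_bilinear)
  also have "\<dots> = Diag x + t *\<^sub>R (H - block_part (($) x) H) + t\<^sup>2 *\<^sub>R conj_rem (off_gen x H) t (Diag x)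
     + t *\<^sub>R (Z + t *\<^sub>R (off_gen x H ** Z - Z ** off_gen x H) + t\<^sup>2 *\<^sub>R conj_rem (off_gen x H) t Z)"
    by (simp add: Q_def conj_expansion[OF A] commutator_off_gen)
  finally show ?thesis
    by (simp add: path_rem_def Let_def scaleR_add_right scaleR_diff_right power2_eq_square algebra_simps)
qed

text \<open>The limit \<open>E\<close> stays anonymous: later steps use only its existence and its
  pairing with diagonal matrices.\<close>

lemma tendsto_path_rem:
  fixes x :: "real^'n" and H :: "real^'n^'n"
  assumes H: "symmetric_mat H" and t: "(t \<longlongrightarrow> 0) F" and z: "(z \<longlongrightarrow> block_part (($) x) H) F"
  obtains E where "((\<lambda>k. path_rem x H (t k) (z k)) \<longlongrightarrow> E) F"
    "\<And>y. 2 * inner (Diag y) E = - curvature x y H"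
proof
  note A = transpose_off_gen[OF H, of x]
  let ?A = "off_gen x H" and ?B = "block_part (($) x) H"
  let ?E = "(1/2) *\<^sub>R (?A ** ?A ** Diag x + Diag x ** ?A ** ?A) - ?A ** Diag x ** ?A + (?A ** ?B - ?B ** ?A)"
  have "((\<lambda>k. path_rem x H (t k) (z k)) \<longlongrightarrow>
     ?E + 0 *\<^sub>R ((1/2) *\<^sub>R (?A ** ?A ** ?B + ?B ** ?A ** ?A) - ?A ** ?B ** ?A)) F"
    unfolding path_rem_def Let_def
    by (intro tendsto_intros tendsto_conj_rem tendsto_matrix_mult A t z)
  then show "((\<lambda>k. path_rem x H (t k) (z k)) \<longlongrightarrow> ?E) F" by simp
  show "2 * inner (Diag y) ?E = - curvature x y H" for y
    by (rule inner_second_order_off_gen[OF H])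
qed

text \<open>Strict gaps of \<open>x\<close> survive small perturbations, and among tied entries of
  \<open>x\<close> the order is decided by \<open>h\<close>.\<close>

lemma eventually_nonincreasing_vec:
  assumes x: "nonincreasing_vec x" and h: "\<And>i j. i \<le> j \<Longrightarrow> x $ i = x $ j \<Longrightarrow> h $ j \<le> h $ i"
    and t: "(t \<longlongrightarrow> 0) F" "eventually (\<lambda>k. t k > 0) F"
  shows "eventually (\<lambda>k. nonincreasing_vec (x + t k *\<^sub>R h)) F"
proof -
  have "eventually (\<lambda>k. i \<le> j \<longrightarrow> (x + t k *\<^sub>R h) $ j \<le> (x + t k *\<^sub>R h) $ i) F" for i j
  proof (cases "i \<le> j")
    case ij: True
    show ?thesis
    proof (cases "x $ i = x $ j")
      case True
      show ?thesis
        using t(2) by eventually_elim (use h[OF ij True] True in \<open>auto intro: mult_left_mono\<close>)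
    next
      case False
      moreover have "x $ j \<le> x $ i" using x ij by (simp add: nonincreasing_vec_def)
      ultimately have "x $ j < x $ i" by simp
      moreover have "((\<lambda>k. x $ i + t k * h $ i - (x $ j + t k * h $ j)) \<longlongrightarrow> x $ i + 0 * h $ i - (x $ j + 0 * h $ j)) F"
        by (intro tendsto_intros t)
      ultimately have "eventually (\<lambda>k. 0 < x $ i + t k * h $ i - (x $ j + t k * h $ j)) F"
        by (intro order_tendstoD(1)) auto
      then show ?thesis by eventually_elim auto
    qed
  qed simp
  then show ?thesis
    unfolding nonincreasing_vec_def by (simp add: eventually_all_finite)
qed

section \<open>Directional derivative of the eigenvalues\<close>

text \<open>Here \<open>x\<close> stands for \<open>eigs (Diag x)\<close>, with which it agrees when
  it is nonincreasing.\<close>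

definition eigs_quot :: "real^('n::{finite,linorder}) \<Rightarrow> real \<Rightarrow> real^('n::{finite,linorder})^('n::{finite,linorder}) \<Rightarrow> real^('n::{finite,linorder})" where
  "eigs_quot x t K = (1 / t) *\<^sub>R (eigs (Diag x + t *\<^sub>R K) - x)"

lemma eigs_quot_eq: "t \<noteq> 0 \<Longrightarrow> x + t *\<^sub>R eigs_quot x t K = eigs (Diag x + t *\<^sub>R K)"
  by (simp add: eigs_quot_def)

text \<open>Conjugating \<open>Diag x\<close> plus \<open>t k\<close> times the block part of
  \<open>H\<close> by the Cayley factor gives a matrix with eigenvalues exactly
  \<open>x + t k *\<^sub>R h\<close> once these are sorted. It differs from
  \<open>Diag x + t k *\<^sub>R K k\<close> by \<open>t k\<close> times a null sequence, and ordered
  eigenvalues are 1-Lipschitz.\<close>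

lemma tendsto_eigs_quot:
  assumes x: "nonincreasing_vec x" and h: "\<And>i j. i \<le> j \<Longrightarrow> x $ i = x $ j \<Longrightarrow> h $ j \<le> h $ i"
    and H: "symmetric_mat H" and Q: "orthogonal_matrix Q" "block_mat (($) x) Q"
    and B: "block_part (($) x) H = Q ** Diag h ** transpose Q"
    and t: "(t \<longlongrightarrow> 0) F" "eventually (\<lambda>k. t k > 0) F"
    and K: "(K \<longlongrightarrow> H) F" "eventually (\<lambda>k. symmetric_mat (K k)) F"
  shows "((\<lambda>k. eigs_quot x (t k) (K k)) \<longlongrightarrow> h) F"
proof -
  let ?B = "block_part (($) x) H"
  obtain E where E: "((\<lambda>k. path_rem x H (t k) ?B) \<longlongrightarrow> E) F"
    using tendsto_path_rem[OF H t(1) tendsto_const] by metis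
  have "((\<lambda>k. (K k - H) - t k *\<^sub>R path_rem x H (t k) ?B) \<longlongrightarrow> (H - H) - 0 *\<^sub>R E) F"
    by (intro tendsto_intros K E t)
  then have lim: "((\<lambda>k. (K k - H) - t k *\<^sub>R path_rem x H (t k) ?B) \<longlongrightarrow> 0) F" by simp
  have ev: "eventually (\<lambda>k. nonincreasing_vec (x + t k *\<^sub>R h)) F"
    by (rule eventually_nonincreasing_vec[OF x _ t]) (rule h)
  have "eventually (\<lambda>k. norm (eigs_quot x (t k) (K k) - h)
      \<le> norm ((K k - H) - t k *\<^sub>R path_rem x H (t k) ?B) * 1) F"
    using ev t(2) K(2)
  proof eventually_elim
    case (elim k)
    define P where "P = cayley (off_gen x H) (t k)"
    have P: "orthogonal_matrix P"
      unfolding P_def by (rule orthogonal_cayley[OF transpose_off_gen[OF H]])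
    let ?Z = "P ** (Diag x + t k *\<^sub>R ?B) ** transpose P"
    have "Q ** Diag x ** transpose Q = Diag x" by (rule block_mat_conj_Diag[OF Q(2,1)])
    then have "Diag x + t k *\<^sub>R ?B = Q ** Diag (x + t k *\<^sub>R h) ** transpose Q"
      by (simp add: B Diag_add Diag_scaleR matrix_mult_bilinear)
    then have "?Z = (P ** Q) ** Diag (x + t k *\<^sub>R h) ** transpose (P ** Q)"
      by (simp add: matrix_transpose_mul matrix_mul_assoc)
    then have eZ: "eigs ?Z = x + t k *\<^sub>R h"
      by (intro eigs_eqI[OF elim(1), of "P ** Q"] orthogonal_matrix_mul P Q)
    have symZ: "symmetric_mat ?Z"
      by (intro symmetric_mat_conj symmetric_mat_add symmetric_mat_scaleR symmetric_mat_block_part H)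
        simp
    have symK: "symmetric_mat (Diag x + t k *\<^sub>R K k)"
      by (intro symmetric_mat_add symmetric_mat_scaleR elim) simp
    have "eigs_quot x (t k) (K k) - h = (1 / t k) *\<^sub>R (eigs (Diag x + t k *\<^sub>R K k) - eigs ?Z)"
      using elim(2) by (simp add: eZ eigs_quot_def scaleR_diff_right scaleR_add_right)
    then have "norm (eigs_quot x (t k) (K k) - h) = (1 / t k) * norm (eigs (Diag x + t k *\<^sub>R K k) - eigs ?Z)"
      using elim(2) by simp
    also have "\<dots> \<le> (1 / t k) * norm (Diag x + t k *\<^sub>R K k - ?Z)"
      using elim(2) by (intro mult_left_mono norm_eigs_diff_le symK symZ) simp
    also have "Diag x + t k *\<^sub>R K k - ?Z = t k *\<^sub>R ((K k - H) - t k *\<^sub>R path_rem x H (t k) ?B)"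
      unfolding P_def path_expansion[OF H] by (simp add: power2_eq_square algebra_simps)
    finally show ?case using elim(2) by simp
  qed
  from tendsto_0_le[OF lim this] show ?thesis
    by (simp add: Lim_null[symmetric])
qed

lemma block_part_spectral:
  fixes H :: "real^('n::{finite,linorder})^('n::{finite,linorder})"
  assumes H: "symmetric_mat H"
  obtains Q h where "orthogonal_matrix Q" "block_mat (($) x) Q"
    "block_part (($) x) H = Q ** Diag h ** transpose Q"
    "\<And>i j. i \<le> j \<Longrightarrow> x $ i = x $ j \<Longrightarrow> h $ j \<le> h $ i"
  by (rule block_spectral[OF symmetric_mat_block_part[OF H] block_mat_block_part, of "($) x"])
    (rule that)

lemma inner_block_part:
  assumes "block_mat C M"
  shows "inner M (block_part C H) = inner M H"
  unfolding inner_matrix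
proof (intro sum.cong refl)
  fix i j show "M $ i $ j * block_part C H $ i $ j = M $ i $ j * H $ i $ j"
    using assms by (auto simp: block_mat_def block_part_def)
qed

text \<open>Fan's inequality with a \<open>Q\<close> that commutes with \<open>Diag x\<close>: the
  zeroth-order terms cancel and \<open>t\<close> divides out.\<close>

lemma inner_eigs_quot_ge:
  assumes x: "nonincreasing_vec x" and y: "nonincreasing_vec y" and K: "symmetric_mat K"
    and t: "t > 0" and Q: "orthogonal_matrix Q" "block_mat (($) x) Q"
  shows "inner (Diag y) (transpose Q ** K ** Q) \<le> inner y (eigs_quot x t K)"
proof -
  have "symmetric_mat (Diag x + t *\<^sub>R K)"
    by (intro symmetric_mat_add symmetric_mat_scaleR K) simp
  from fan_inequality[OF y this Q(1)]
  have "inner (Diag y) (transpose Q ** (Diag x + t *\<^sub>R K) ** Q) \<le> inner y (eigs (Diag x + t *\<^sub>R K))"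
    by (simp add: inner_conj)
  moreover have "transpose Q ** Diag x ** Q = Diag x"
    using block_mat_conj_Diag[of "($) x" "transpose Q" x] Q by (simp add: block_mat_transpose)
  ultimately have "inner y x + t * inner (Diag y) (transpose Q ** K ** Q) \<le> inner y (x + t *\<^sub>R eigs_quot x t K)"
    using t by (simp add: eigs_quot_eq matrix_mult_bilinear inner_add_right inner_Diag_Diag)
  then show ?thesis using t by (simp add: inner_add_right)
qed

text \<open>When \<open>\<langle>y, h\<rangle> = \<langle>Diag y, H\<rangle>\<close>, the identity attains the maximum in Fan's inequality over the
  orthogonal matrices commuting with \<open>Diag x\<close>; the first-order conditions make the diagonal
  blocks of \<open>H\<close> commute with \<open>Diag y\<close>.\<close>
lemma block_part_simultaneous_spectral:
  assumes x: "nonincreasing_vec x" and y: "nonincreasing_vec y" and H: "symmetric_mat H"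
    and lim: "((\<lambda>t. eigs_quot x t H) \<longlongrightarrow> h) (at_right 0)"
    and le: "inner y h \<le> inner (Diag y) H"
  obtains Q where "orthogonal_matrix Q" "block_mat (\<lambda>i. (x $ i, y $ i)) Q"
    "block_part (($) x) H = Q ** Diag h ** transpose Q"
proof -
  let ?B = "block_part (($) x) H" and ?C = "\<lambda>i. (x $ i, y $ i)"
  have B: "symmetric_mat ?B" by (rule symmetric_mat_block_part[OF H])
  \<comment> \<open>The limit of \<open>inner_eigs_quot_ge\<close> as \<open>t\<close> decreases to
    0; by the hypothesis \<open>le\<close> the upper bound is attained at the identity.\<close>
  have max: "inner (Diag y) (transpose R ** ?B ** R) \<le> inner (Diag y) ?B"
    if R: "orthogonal_matrix R" "block_mat (($) x) R" for R
  proof -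
    have "inner (Diag y) (transpose R ** H ** R) \<le> inner y h"
    proof (rule tendsto_lowerbound)
      show "((\<lambda>t. inner y (eigs_quot x t H)) \<longlongrightarrow> inner y h) (at_right 0)"
        by (intro tendsto_intros lim)
      show "eventually (\<lambda>t. inner (Diag y) (transpose R ** H ** R) \<le> inner y (eigs_quot x t H)) (at_right 0)"
        using eventually_at_right_less[of 0]
        by eventually_elim (rule inner_eigs_quot_ge[OF x y H _ R])
    qed simp
    moreover have "inner (Diag y) (transpose R ** ?B ** R) = inner (Diag y) (transpose R ** H ** R)"
      unfolding inner_conj[symmetric]
      by (intro inner_block_part block_mat_mult block_mat_Diag block_mat_transpose R)
    ultimately show ?thesis using le by (simp add: inner_Diag_block_part)
  qed
  \<comment> \<open>Between indices with equal \<open>x\<close> and different \<open>y\<close>, the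
    stationarity condition makes the entries of \<open>?B\<close> vanish.\<close>
  have BC: "block_mat ?C ?B"
    unfolding block_mat_def
  proof (intro allI impI)
    fix k l assume kl: "?C k \<noteq> ?C l"
    show "?B $ k $ l = 0"
    proof (cases "x $ k = x $ l")
      case True
      with kl have kl': "k \<noteq> l" "y $ k \<noteq> y $ l" by auto
      have "(y $ k - y $ l) * ?B $ k $ l = 0"
        using maximal_orthogonal_conj[OF B True kl'(1) max] by blast
      with kl' show ?thesis by (simp only: mult_eq_0_iff right_minus_eq) blast
    qed (simp add: block_part_def)
  qed
  \<comment> \<open>Diagonalizing over the finer classes makes \<open>Q\<close> commute with
    \<open>Diag x\<close> and \<open>Diag y\<close>, but orders \<open>h'\<close> only where both
    \<open>x\<close> and \<open>y\<close> agree.\<close>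
  obtain Q h' where Q: "orthogonal_matrix Q" "block_mat ?C Q" "?B = Q ** Diag h' ** transpose Q"
    and h': "\<And>i j. i \<le> j \<Longrightarrow> ?C i = ?C j \<Longrightarrow> h' $ j \<le> h' $ i"
    by (rule block_spectral[OF B BC]) (rule that)
  have Qx: "block_mat (($) x) Q" using Q(2) by (auto simp: block_mat_def)
  have QB: "transpose Q ** ?B ** Q = Diag h'"
    unfolding Q(3) by (simp add: matrix_mul_assoc orthogonal_matrixD[OF Q(1)])
  have QyB: "inner (Diag y) (Diag h') = inner (Diag y) ?B"
  proof -
    have "Q ** Diag y ** transpose Q = Diag y"
      by (rule block_mat_conj_Diag[OF Q(2,1)]) simp
    then show ?thesis using inner_conj[of Q "Diag y" ?B] by (simp add: QB)
  qed
  have max': "inner (Diag y) (transpose R ** Diag h' ** R) \<le> inner (Diag y) (Diag h')"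
    if R: "orthogonal_matrix R" "block_mat (($) x) R" for R
    using max[of "Q ** R"] Q(1) Qx R unfolding QyB
    by (simp add: orthogonal_matrix_mul block_mat_mult matrix_transpose_mul matrix_mul_assoc flip: QB)
  \<comment> \<open>Where \<open>x\<close> ties and \<open>y\<close> does not, the inequality from
    maximality supplies the missing order.\<close>
  have sorted: "h' $ j \<le> h' $ i" if ij: "i \<le> j" "x $ i = x $ j" for i j
  proof (cases "y $ i = y $ j")
    case True
    then show ?thesis using h' ij by simp
  next
    case False
    moreover have "y $ j \<le> y $ i" using y ij by (simp add: nonincreasing_vec_def)
    ultimately have "y $ j < y $ i" "i \<noteq> j" by auto
    moreover have "0 \<le> (y $ i - y $ j) * (Diag h' $ i $ i - Diag h' $ j $ j)"
      using maximal_orthogonal_conj[OF symmetric_mat_Diag ij(2) \<open>i \<noteq> j\<close> max'] by blast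
    ultimately show ?thesis
      by (simp add: Diag_nth zero_le_mult_iff)
  qed
  \<comment> \<open>Now that \<open>h'\<close> is sorted in every class of \<open>x\<close>, it is
    the directional derivative, and uniqueness of limits identifies it with
    \<open>h\<close>.\<close>
  have "((\<lambda>t. eigs_quot x t H) \<longlongrightarrow> h') (at_right 0)"
    by (rule tendsto_eigs_quot[OF x sorted H Q(1) Qx Q(3)])
       (auto simp: eventually_at_right_less H tendsto_ident_at)
  then have "h' = h" using lim by (intro tendsto_unique[OF trivial_limit_at_right_real])
  then show thesis using that Q by blast
qed

section \<open>Second subderivative at a diagonal matrix\<close>

lemma Liminf_filterlim:
  fixes f :: "'b \<Rightarrow> 'c::complete_linorder"
  assumes "filterlim \<phi> G F"
  shows "Liminf G f \<le> Liminf F (\<lambda>x. f (\<phi> x))"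
  unfolding le_Liminf_iff
proof (intro allI impI)
  fix c assume "c < Liminf G f"
  then have "eventually (\<lambda>x. c < f x) G" by (rule less_LiminfD)
  from eventually_compose_filterlim[OF this assms] show "eventually (\<lambda>x. c < f (\<phi> x)) F" .
qed

lemma Liminf_add_tendsto_le:
  fixes f :: "'a \<Rightarrow> ereal"
  assumes r: "(r \<longlongrightarrow> s) F"
  shows "Liminf F f + ereal s \<le> Liminf F (\<lambda>x. f x + ereal (r x))"
  unfolding le_Liminf_iff
proof (intro allI impI)
  fix c assume c: "c < Liminf F f + ereal s"
  then have "c - ereal s < Liminf F f"
    by (cases c; cases "Liminf F f") auto
  \<comment> \<open>A real \<open>z\<close> strictly in between splits the claim: eventually
    \<open>f\<close> exceeds \<open>z\<close> and \<open>r\<close> exceeds the difference of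
    \<open>c\<close> and \<open>z\<close>.\<close>
  then obtain z where z: "c - ereal s < ereal z" "ereal z < Liminf F f" using ereal_dense2 by blast
  from z(2) have ev: "eventually (\<lambda>x. ereal z < f x) F" by (rule less_LiminfD)
  show "eventually (\<lambda>x. c < f x + ereal (r x)) F"
  proof (cases c)
    case (real c')
    then have "c' - z < s" using z(1) by simp
    with r have "eventually (\<lambda>x. c' - z < r x) F" by (rule order_tendstoD(1))
    with ev show ?thesis
    proof eventually_elim
      case (elim x)
      then show ?case using real by (cases "f x") auto
    qed
  next
    case PInf
    then show ?thesis using c by simp
  next
    case MInf
    from ev show ?thesis by eventually_elim (auto simp: MInf plus_ereal.simps ereal_less_eq(1))
  qed
qed

lemma filterlim_fst_at_right:
  "(fst \<longlongrightarrow> 0) (at_right (0::real) \<times>\<^sub>F G)" "eventually (\<lambda>p. fst p > 0) (at_right (0::real) \<times>\<^sub>F G)"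
proof -
  have f: "filterlim fst (at_right (0::real)) (at_right 0 \<times>\<^sub>F G)" by (rule filterlim_fst)
  then show "(fst \<longlongrightarrow> 0) (at_right (0::real) \<times>\<^sub>F G)" by (simp add: filterlim_at)
  show "eventually (\<lambda>p. fst p > 0) (at_right (0::real) \<times>\<^sub>F G)"
    by (rule eventually_compose_filterlim[OF eventually_at_right_less f])
qed

lemma filterlim_sequence_at_right_nhds:
  assumes "\<And>k. t k > 0" "t \<longlonglongrightarrow> 0" "w \<longlonglongrightarrow> (W::'a::topological_space)"
  shows "filterlim (\<lambda>k. (t k, w k)) (at_right (0::real) \<times>\<^sub>F nhds W) sequentially"
proof -
  have "t k \<noteq> 0" for k using assms(1)[of k] by simp
  then show ?thesis
    by (intro filterlim_Pair) (use assms in \<open>auto simp: filterlim_at\<close>)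
qed

lemma sec_subderiv_le_lim:
  assumes "\<And>k. t k > 0" "t \<longlonglongrightarrow> 0" "w \<longlonglongrightarrow> W" "(\<lambda>k. sec_quot f x v (t k) (w k)) \<longlonglongrightarrow> l"
  shows "sec_subderiv f x v W \<le> l"
proof -
  have "sec_subderiv f x v W \<le> liminf (\<lambda>k. sec_quot f x v (t k) (w k))"
    using Liminf_filterlim[OF filterlim_sequence_at_right_nhds[OF assms(1-3)], of "\<lambda>(t, w'). sec_quot f x v t w'"]
    by (simp add: sec_subderiv_def)
  also have "\<dots> = l" using assms(4) by (intro lim_imp_Liminf) auto
  finally show ?thesis .
qed

lemma ereal_quot_shift:
  assumes "d > 0" "a \<noteq> -\<infinity>"
  shows "(a - ereal b - ereal c) / ereal d = (a - ereal b - ereal c') / ereal d + ereal ((c' - c) / d)"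
  using assms by (cases a) (auto simp: diff_divide_distrib)

section \<open>Spectral functions and the comparison of their second difference quotients\<close>

definition spectral_pair :: "(real^('n::{finite,linorder})^('n::{finite,linorder}) \<Rightarrow> ereal) \<Rightarrow> (real^('n::{finite,linorder}) \<Rightarrow> ereal) \<Rightarrow> bool" where
  "spectral_pair g \<theta> \<longleftrightarrow> (\<forall>A. g A = (if symmetric_mat A then \<theta> (eigs A) else \<infinity>)) \<and>
     (\<forall>x. \<theta> x = g (Diag x)) \<and> (\<forall>A. g A \<noteq> -\<infinity>)"

lemma spectral_pairD:
  assumes "spectral_pair g \<theta>"
  shows "symmetric_mat A \<Longrightarrow> g A = \<theta> (eigs A)" "\<not> symmetric_mat A \<Longrightarrow> g A = \<infinity>"
    "g (Diag x) = \<theta> x" "\<theta> x \<noteq> -\<infinity>"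
  using assms unfolding spectral_pair_def by metis+

lemma spectral_conj:
  assumes s: "spectral_pair g \<theta>" and Q: "orthogonal_matrix Q"
  shows "g (Q ** A ** transpose Q) = g A"
  using symmetric_mat_conj_iff[OF Q, of A] eigs_conj[OF _ Q, of A] spectral_pairD[OF s] by metis

lemma subdiff_finite: "v \<in> subdiff f x \<Longrightarrow> \<exists>b. f x = ereal b"
  by (cases "f x") (auto simp: subdiff_def)

lemma subdiff_Diag:
  assumes s: "spectral_pair g \<theta>" and "Diag y \<in> subdiff g (Diag x)"
  shows "y \<in> subdiff \<theta> x"
proof -
  have "g (Diag x) + ereal (inner (Diag y) (Diag z - Diag x)) \<le> g (Diag z)" for z
    using assms(2) by (simp add: subdiff_def)
  then show ?thesis
    using assms(2) by (simp add: subdiff_def spectral_pairD(3)[OF s] inner_Diag_Diag flip: Diag_diff)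
qed

lemma sec_quot_nonneg:
  assumes v: "v \<in> subdiff f x" and t: "t > 0"
  shows "0 \<le> sec_quot f x v t w"
proof -
  obtain b where b: "f x = ereal b" using subdiff_finite[OF v] by blast
  have "f x + ereal (inner v ((x + t *\<^sub>R w) - x)) \<le> f (x + t *\<^sub>R w)"
    using v unfolding subdiff_def by blast
  then have "ereal (b + t * inner v w) \<le> f (x + t *\<^sub>R w)" by (simp add: b)
  then show ?thesis
    unfolding sec_quot_def b using t by (cases "f (x + t *\<^sub>R w)") auto
qed

text \<open>The scaled defect in the first-order form of Fan's inequality. It is the amount by which
  the second difference quotient of \<open>g\<close> exceeds that of \<theta>.\<close>

definition fan_gap :: "real^('n::{finite,linorder}) \<Rightarrow> real^('n::{finite,linorder}) \<Rightarrow> real \<Rightarrow> real^('n::{finite,linorder})^('n::{finite,linorder}) \<Rightarrow> real" where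
  "fan_gap x y t K = 2 * (inner y (eigs_quot x t K) - inner (Diag y) K) / t"

text \<open>Both quotients contain the same function values; only the subtracted linear terms
  differ.\<close>

lemma sec_quot_spectral:
  assumes s: "spectral_pair g \<theta>" and b: "\<theta> x = ereal b" and K: "symmetric_mat K" and t: "t > 0"
  shows "sec_quot g (Diag x) (Diag y) t K = sec_quot \<theta> x y t (eigs_quot x t K) + ereal (fan_gap x y t K)"
proof -
  have sym: "symmetric_mat (Diag x + t *\<^sub>R K)"
    by (intro symmetric_mat_add symmetric_mat_scaleR K) simp
  have gap: "fan_gap x y t K = (t * inner y (eigs_quot x t K) - t * inner (Diag y) K) / (t\<^sup>2 / 2)"
    using t by (simp add: fan_gap_def power2_eq_square field_simps)
  have "x + t *\<^sub>R eigs_quot x t K = eigs (Diag x + t *\<^sub>R K)" using t by (simp add: eigs_quot_eq)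
  then show ?thesis
    unfolding sec_quot_def spectral_pairD(1)[OF s sym] spectral_pairD(3)[OF s] b gap
    using t by (simp only:) (intro ereal_quot_shift spectral_pairD(4)[OF s], simp)
qed

text \<open>Fan's inequality is tested at the Cayley factor \<open>P\<close> that also generates the
  path tangent to \<open>H\<close>. Orthogonal invariance then cancels the terms of order zero and
  one, and the second-order terms form \<open>?r\<close>.\<close>

lemma fan_gap_lower_bound:
  assumes x: "nonincreasing_vec x" and y: "nonincreasing_vec y" and H: "symmetric_mat H"
    and t: "(t \<longlongrightarrow> 0) F" "eventually (\<lambda>k. t k > 0) F"
    and K: "(K \<longlongrightarrow> H) F" "eventually (\<lambda>k. symmetric_mat (K k)) F"
  obtains r where "(r \<longlongrightarrow> curvature x y H) F" "eventually (\<lambda>k. r k \<le> fan_gap x y (t k) (K k)) F"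
proof
  let ?A = "off_gen x H" and ?B = "block_part (($) x) H" and ?Y = "Diag y"
  note A = transpose_off_gen[OF H, of x]
  \<comment> \<open>The difference quotient at \<open>t\<close> of the conjugation of
    \<open>?Y\<close> by the Cayley factor.\<close>
  let ?G = "\<lambda>t. ?A ** ?Y - ?Y ** ?A + t *\<^sub>R conj_rem ?A t ?Y"
  let ?r = "\<lambda>k. 2 * inner (?G (t k)) (K k - H) - 2 * inner (?Y + t k *\<^sub>R ?G (t k)) (path_rem x H (t k) ?B)"
  obtain E where E: "((\<lambda>k. path_rem x H (t k) ?B) \<longlongrightarrow> E) F" "\<And>y. 2 * inner (Diag y) E = - curvature x y H"
    by (rule tendsto_path_rem[OF H t(1) tendsto_const]) (rule that)
  have "((\<lambda>k. ?G (t k)) \<longlongrightarrow> ?A ** ?Y - ?Y ** ?A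
      + 0 *\<^sub>R ((1/2) *\<^sub>R (?A ** ?A ** ?Y + ?Y ** ?A ** ?A) - ?A ** ?Y ** ?A)) F"
    by (intro tendsto_intros tendsto_conj_rem[OF A t(1) tendsto_const] t)
  then obtain G where G: "((\<lambda>k. ?G (t k)) \<longlongrightarrow> G) F" by blast
  have "(?r \<longlongrightarrow> 2 * inner G (H - H) - 2 * inner (?Y + 0 *\<^sub>R G) E) F"
    by (intro tendsto_intros G E K t)
  then show "(?r \<longlongrightarrow> curvature x y H) F" by (simp add: E(2))
  show "eventually (\<lambda>k. ?r k \<le> fan_gap x y (t k) (K k)) F"
    using t(2) K(2)
  proof eventually_elim
    case (elim k)
    define s where "s = t k"
    have s: "s > 0" using elim by (simp add: s_def)
    define P where "P = cayley ?A s"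
    have P: "orthogonal_matrix P" unfolding P_def by (rule orthogonal_cayley[OF A])
    have sym: "symmetric_mat (Diag x + s *\<^sub>R K k)"
      by (intro symmetric_mat_add symmetric_mat_scaleR elim) simp
    let ?E = "path_rem x H s ?B"
    have Z: "Diag x + s *\<^sub>R K k = P ** (Diag x + s *\<^sub>R ?B) ** transpose P + s *\<^sub>R (K k - H) - s\<^sup>2 *\<^sub>R ?E"
      unfolding P_def path_expansion[OF H] by (simp add: scaleR_diff_right)
    have PY: "P ** ?Y ** transpose P = ?Y + s *\<^sub>R ?G s"
      unfolding P_def conj_expansion[OF A] by (simp add: scaleR_add_right power2_eq_square)
    \<comment> \<open>Both arguments are conjugates by the same \<open>P\<close>, and the block part
      has the diagonal of \<open>H\<close>.\<close>
    have main: "inner (?Y + s *\<^sub>R ?G s) (P ** (Diag x + s *\<^sub>R ?B) ** transpose P) = inner y x + s * inner ?Y H"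
      unfolding PY[symmetric] inner_orthogonal_conj[OF P]
      by (simp add: inner_add_right inner_Diag_Diag inner_Diag_block_part)
    have "inner (P ** ?Y ** transpose P) (Diag x + s *\<^sub>R K k) \<le> inner y (eigs (Diag x + s *\<^sub>R K k))"
      by (rule fan_inequality[OF y sym P])
    also have "eigs (Diag x + s *\<^sub>R K k) = x + s *\<^sub>R eigs_quot x s (K k)"
      using s by (simp add: eigs_quot_eq)
    also have "inner (P ** ?Y ** transpose P) (Diag x + s *\<^sub>R K k) =
      inner y x + s * inner ?Y H + s * inner (?Y + s *\<^sub>R ?G s) (K k - H) - s\<^sup>2 * inner (?Y + s *\<^sub>R ?G s) ?E"
      unfolding Z PY by (simp add: main inner_add_right inner_diff_right)
    finally have "s\<^sup>2 * inner (?G s) (K k - H) - s\<^sup>2 * inner (?Y + s *\<^sub>R ?G s) ?E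
      \<le> s * (inner y (eigs_quot x s (K k)) - inner ?Y (K k))"
      by (simp add: inner_add_left[of ?Y "s *\<^sub>R ?G s" "K k - H"] inner_add_right inner_diff_right[of ?Y]
           power2_eq_square algebra_simps)
    moreover define a c q where "a = inner (?G s) (K k - H)" and "c = inner (?Y + s *\<^sub>R ?G s) ?E"
      and "q = inner y (eigs_quot x s (K k)) - inner ?Y (K k)"
    ultimately have "s\<^sup>2 * a - s\<^sup>2 * c \<le> s * q" by (simp only: a_def c_def q_def)
    then have "s * (s * (a - c)) \<le> s * q" by (simp add: power2_eq_square algebra_simps)
    then have "s * (a - c) \<le> q" using s by (simp add: mult_le_cancel_left_pos)
    then have "(2 * a - 2 * c) * s \<le> 2 * q" by (simp add: algebra_simps)
    then have "2 * a - 2 * c \<le> 2 * q / s" using s by (simp only: pos_le_divide_eq)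
    then show ?case unfolding a_def c_def q_def fan_gap_def s_def by simp
  qed
qed

section \<open>Directions outside the space of symmetric matrices\<close>

lemma open_not_symmetric: "open {K::real^'n^'n. \<not> symmetric_mat K}"
proof -
  have "closed {K::real^'n^'n. transpose K = K}"
    by (intro closed_Collect_eq linear_continuous_on bounded_linear_transpose continuous_on_id)
  then show ?thesis by (simp add: symmetric_mat_def closed_def Collect_neg_eq)
qed

lemma not_symmetric_add_scaleR:
  assumes "symmetric_mat X" "\<not> symmetric_mat K" "t \<noteq> 0"
  shows "\<not> symmetric_mat (X + t *\<^sub>R K)"
proof
  assume "symmetric_mat (X + t *\<^sub>R K)"
  then have "symmetric_mat ((1/t) *\<^sub>R ((X + t *\<^sub>R K) - X))"
    by (intro symmetric_mat_scaleR symmetric_mat_diff assms)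
  with assms show False by simp
qed

lemma eventually_not_symmetric:
  assumes "\<not> symmetric_mat H"
  shows "eventually (\<lambda>(t, K). t > 0 \<and> \<not> symmetric_mat K) (at_right (0::real) \<times>\<^sub>F nhds H)"
proof -
  have "eventually (\<lambda>K. \<not> symmetric_mat K) (nhds H)"
    using eventually_nhds_in_open[OF open_not_symmetric, of H] assms by simp
  then have "eventually (\<lambda>p. \<not> symmetric_mat (snd p)) (at_right (0::real) \<times>\<^sub>F nhds H)"
    by (rule eventually_compose_filterlim[OF _ filterlim_snd])
  with filterlim_fst_at_right(2) show ?thesis
    by eventually_elim auto
qed

text \<open>Nonsymmetric directions form an open set on which \<open>g\<close> is infinite after any
  positive step. Hence a finite derivative forces \<open>H\<close> to be symmetric, although limits
  are taken in the space of all matrices.\<close>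

lemma not_symmetric_derivatives:
  assumes s: "spectral_pair g \<theta>" and b: "\<theta> x = ereal b" and H: "\<not> symmetric_mat H"
  shows "sec_subderiv g (Diag x) V H = \<infinity>" "subderiv g (Diag x) H = \<infinity>"
proof -
  have g: "g (Diag x + t *\<^sub>R K) = \<infinity>" if "t > 0" "\<not> symmetric_mat K" for t K
    using that by (intro spectral_pairD(2)[OF s] not_symmetric_add_scaleR) auto
  have "\<infinity> \<le> sec_subderiv g (Diag x) V H"
    unfolding sec_subderiv_def
    by (rule Liminf_bounded, rule eventually_mono[OF eventually_not_symmetric[OF H]])
       (auto simp: sec_quot_def g spectral_pairD(3)[OF s] b)
  then show "sec_subderiv g (Diag x) V H = \<infinity>" by simp
  have "\<infinity> \<le> subderiv g (Diag x) H"
    unfolding subderiv_def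
    by (rule Liminf_bounded, rule eventually_mono[OF eventually_not_symmetric[OF H]])
       (auto simp: g spectral_pairD(3)[OF s] b)
  then show "subderiv g (Diag x) H = \<infinity>" by simp
qed

text \<open>Neighbourhoods of \<open>H\<close> contain nonsymmetric matrices, for which
  \<open>eigs\<close> carries no information. Sending them to \<open>H\<close> keeps convergence to
  \<open>H\<close>.\<close>

definition sym_retract :: "real^'n^'n \<Rightarrow> real^'n^'n \<Rightarrow> real^'n^'n" where
  "sym_retract H K = (if symmetric_mat K then K else H)"

lemma symmetric_sym_retract: "symmetric_mat H \<Longrightarrow> symmetric_mat (sym_retract H K)"
  by (simp add: sym_retract_def)

lemma tendsto_sym_retract:
  assumes "(K \<longlongrightarrow> H) F" shows "((\<lambda>k. sym_retract H (K k)) \<longlongrightarrow> H) F"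
proof -
  have lim: "((\<lambda>k. K k - H) \<longlongrightarrow> 0) F" using assms by (simp add: Lim_null[symmetric])
  have "norm (sym_retract H (K k) - H) \<le> norm (K k - H) * 1" for k
    by (simp add: sym_retract_def)
  from tendsto_0_le[OF lim always_eventually[OF allI[OF this]]] show ?thesis
    by (simp add: Lim_null[symmetric])
qed

text \<open>One \<open>h\<close> serves three purposes: the joint limit for lower bounds, the radial
  limit for recovery sequences, and the identification with \<open>eigs_dir\<close>.\<close>

lemma eigs_quot_limit:
  assumes x: "nonincreasing_vec x" and H: "symmetric_mat H"
  obtains h where
    "((\<lambda>p. eigs_quot x (fst p) (sym_retract H (snd p))) \<longlongrightarrow> h) (at_right 0 \<times>\<^sub>F nhds H)"
    "((\<lambda>t. eigs_quot x t H) \<longlongrightarrow> h) (at_right 0)" "eigs_dir (Diag x) H = h"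
proof -
  obtain Q h where Q: "orthogonal_matrix Q" "block_mat (($) x) Q"
    "block_part (($) x) H = Q ** Diag h ** transpose Q"
    and h: "\<And>i j. i \<le> j \<Longrightarrow> x $ i = x $ j \<Longrightarrow> h $ j \<le> h $ i"
    by (rule block_part_spectral[OF H, of x]) (rule that)
  have lim: "((\<lambda>t. eigs_quot x t H) \<longlongrightarrow> h) (at_right 0)"
    by (rule tendsto_eigs_quot[OF x h H Q]) (auto simp: eventually_at_right_less H tendsto_ident_at)
  then have dir: "eigs_dir (Diag x) H = h"
    unfolding eigs_dir_def by (intro tendsto_Lim) (auto simp: eigs_quot_def eigs_Diag[OF x])
  have "((\<lambda>p. eigs_quot x (fst p) (sym_retract H (snd p))) \<longlongrightarrow> h) (at_right 0 \<times>\<^sub>F nhds H)"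
    by (rule tendsto_eigs_quot[OF x h H Q])
      (auto intro!: filterlim_fst_at_right tendsto_sym_retract filterlim_snd always_eventually symmetric_sym_retract H)
  from that[OF this lim dir] show thesis .
qed

text \<open>The quotient of \<open>g\<close> dominates that of \<theta> plus the Fan gap. The gap is
  bounded below by a function tending to the curvature. When the first-order defect is positive it
  blows up, while the quotient of \<theta> stays nonnegative. The third bound is the subgradient
  inequality of \<theta>.\<close>

lemma spectral_lower_bounds:
  assumes s: "spectral_pair g \<theta>" and x: "nonincreasing_vec x" and y: "nonincreasing_vec y"
    and sub: "y \<in> subdiff \<theta> x" and H: "symmetric_mat H"
    and lim: "((\<lambda>p. eigs_quot x (fst p) (sym_retract H (snd p))) \<longlongrightarrow> h) (at_right 0 \<times>\<^sub>F nhds H)"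
  shows "sec_subderiv \<theta> x y h + ereal (curvature x y H) \<le> sec_subderiv g (Diag x) (Diag y) H"
    and "inner (Diag y) H < inner y h \<Longrightarrow> sec_subderiv g (Diag x) (Diag y) H = \<infinity>"
    and "ereal (inner y h) \<le> subderiv g (Diag x) H"
proof -
  let ?F = "at_right (0::real) \<times>\<^sub>F nhds H"
  let ?K = "\<lambda>p. sym_retract H (snd p)" and ?e = "\<lambda>p. eigs_quot x (fst p) (sym_retract H (snd p))"
  note t = filterlim_fst_at_right[of "nhds H"]
  have K: "(?K \<longlongrightarrow> H) ?F" "eventually (\<lambda>p. symmetric_mat (?K p)) ?F"
    by (auto intro!: tendsto_sym_retract filterlim_snd always_eventually symmetric_sym_retract H)
  obtain b where b: "\<theta> x = ereal b" using subdiff_finite[OF sub] by blast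
  \<comment> \<open>Equality for symmetric directions; otherwise the right side is infinite.\<close>
  have quot: "sec_quot \<theta> x y (fst p) (?e p) + ereal (fan_gap x y (fst p) (?K p))
      \<le> sec_quot g (Diag x) (Diag y) (fst p) (snd p)" if "fst p > 0" for p
  proof (cases "symmetric_mat (snd p)")
    case True
    then show ?thesis using sec_quot_spectral[OF s b True that, of y] by (simp add: sym_retract_def)
  next
    case False
    then have "g (Diag x + fst p *\<^sub>R snd p) = \<infinity>"
      using that by (intro spectral_pairD(2)[OF s] not_symmetric_add_scaleR) auto
    then have "sec_quot g (Diag x) (Diag y) (fst p) (snd p) = \<infinity>"
      using that by (simp add: sec_quot_def spectral_pairD(3)[OF s] b)
    then show ?thesis by simp
  qed
  obtain r where r: "(r \<longlongrightarrow> curvature x y H) ?F" "eventually (\<lambda>p. r p \<le> fan_gap x y (fst p) (?K p)) ?F"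
    by (rule fan_gap_lower_bound[OF x y H t K]) (rule that)
  have phi: "filterlim (\<lambda>p. (fst p, ?e p)) (at_right 0 \<times>\<^sub>F nhds h) ?F"
    by (intro filterlim_Pair filterlim_fst lim)
  have "sec_subderiv \<theta> x y h \<le> Liminf ?F (\<lambda>p. sec_quot \<theta> x y (fst p) (?e p))"
    using Liminf_filterlim[OF phi, of "\<lambda>(t, w'). sec_quot \<theta> x y t w'"] by (simp add: sec_subderiv_def)
  then have "sec_subderiv \<theta> x y h + ereal (curvature x y H)
      \<le> Liminf ?F (\<lambda>p. sec_quot \<theta> x y (fst p) (?e p)) + ereal (curvature x y H)"
    by (rule add_right_mono)
  also have "\<dots> \<le> Liminf ?F (\<lambda>p. sec_quot \<theta> x y (fst p) (?e p) + ereal (r p))"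
    by (rule Liminf_add_tendsto_le[OF r(1)])
  also have "\<dots> \<le> sec_subderiv g (Diag x) (Diag y) H"
    unfolding sec_subderiv_def case_prod_unfold
  proof (rule Liminf_mono)
    show "eventually (\<lambda>p. sec_quot \<theta> x y (fst p) (?e p) + ereal (r p)
        \<le> sec_quot g (Diag x) (Diag y) (fst p) (snd p)) ?F"
      using r(2) t(2)
    proof eventually_elim
      case (elim p)
      have "sec_quot \<theta> x y (fst p) (?e p) + ereal (r p)
          \<le> sec_quot \<theta> x y (fst p) (?e p) + ereal (fan_gap x y (fst p) (?K p))"
        using elim(1) by (intro add_left_mono) simp
      with quot[OF elim(2)] show ?case by (rule order_trans[rotated])
    qed
  qed
  finally show "sec_subderiv \<theta> x y h + ereal (curvature x y H) \<le> sec_subderiv g (Diag x) (Diag y) H" .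

  show "sec_subderiv g (Diag x) (Diag y) H = \<infinity>" if less: "inner (Diag y) H < inner y h"
  proof -
    have "ereal M \<le> sec_subderiv g (Diag x) (Diag y) H" for M
      unfolding sec_subderiv_def case_prod_unfold
    proof (rule Liminf_bounded)
      \<comment> \<open>Half the limiting defect: eventually the defect exceeds \<open>d\<close>,
        and once the step times the absolute value of \<open>M\<close> is below \<open>d\<close>,
        the gap is at least \<open>M\<close>.\<close>
      define d where "d = (inner y h - inner (Diag y) H) / 2"
      have d: "d > 0" using less by (simp add: d_def)
      have "((\<lambda>p. inner y (?e p) - inner (Diag y) (?K p)) \<longlongrightarrow> inner y h - inner (Diag y) H) ?F"
        by (intro tendsto_intros lim K)
      then have ev1: "eventually (\<lambda>p. d < inner y (?e p) - inner (Diag y) (?K p)) ?F"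
        by (rule order_tendstoD(1)) (use less in \<open>simp add: d_def field_simps\<close>)
      have "((\<lambda>p. \<bar>M\<bar> * fst p) \<longlongrightarrow> \<bar>M\<bar> * 0) ?F" by (intro tendsto_intros t)
      then have ev2: "eventually (\<lambda>p. \<bar>M\<bar> * fst p < d) ?F"
        by (rule order_tendstoD(2)) (use d in simp)
      show "eventually (\<lambda>p. ereal M \<le> sec_quot g (Diag x) (Diag y) (fst p) (snd p)) ?F"
        using ev1 ev2 t(2)
      proof eventually_elim
        case (elim p)
        have "M * fst p \<le> \<bar>M\<bar> * fst p" using elim(3) by (intro mult_right_mono) auto
        then have "M * fst p < inner y (?e p) - inner (Diag y) (?K p)" using elim(1,2) by (metis order.strict_trans1 order.strict_trans)
        moreover have "0 < inner y (?e p) - inner (Diag y) (?K p)" using elim(1) d by (rule order.strict_trans[rotated])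
        ultimately have "M * fst p \<le> 2 * (inner y (?e p) - inner (Diag y) (?K p))" by (simp only: mult_2 add_pos_pos less_imp_le less_add_same_cancel1 order.strict_trans)
        then have "M \<le> fan_gap x y (fst p) (?K p)"
          using elim(3) by (simp add: fan_gap_def pos_le_divide_eq)
        then have "0 + ereal M \<le> sec_quot \<theta> x y (fst p) (?e p) + ereal (fan_gap x y (fst p) (?K p))"
          by (intro add_mono sec_quot_nonneg sub elim) simp
        from order_trans[OF this quot[OF elim(3)]] show ?case by (simp only: add_0)
      qed
    qed
    then show ?thesis by (rule ereal_top)
  qed

  have "ereal (inner y h) = Liminf ?F (\<lambda>p. ereal (inner y (?e p)))"
    by (rule lim_imp_Liminf[symmetric]) (auto intro!: tendsto_intros lim simp: prod_filter_eq_bot)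
  also have "\<dots> \<le> subderiv g (Diag x) H"
    unfolding subderiv_def case_prod_unfold
  proof (rule Liminf_mono)
    show "eventually (\<lambda>p. ereal (inner y (?e p)) \<le> (g (Diag x + fst p *\<^sub>R snd p) - g (Diag x)) / ereal (fst p)) ?F"
      using t(2)
    proof eventually_elim
      case (elim p)
      show ?case
      proof (cases "symmetric_mat (snd p)")
        case True
        have "symmetric_mat (Diag x + fst p *\<^sub>R snd p)"
          by (intro symmetric_mat_add symmetric_mat_scaleR True) simp
        then have g: "g (Diag x + fst p *\<^sub>R snd p) = \<theta> (x + fst p *\<^sub>R ?e p)"
          using elim True by (simp add: spectral_pairD(1)[OF s] eigs_quot_eq sym_retract_def)
        have "\<theta> x + ereal (inner y ((x + fst p *\<^sub>R ?e p) - x)) \<le> \<theta> (x + fst p *\<^sub>R ?e p)"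
          using sub unfolding subdiff_def by blast
        then have "ereal (b + fst p * inner y (?e p)) \<le> \<theta> (x + fst p *\<^sub>R ?e p)" by (simp add: b)
        then show ?thesis
          unfolding g spectral_pairD(3)[OF s] b using elim
          by (cases "\<theta> (x + fst p *\<^sub>R ?e p)") (auto simp: pos_le_divide_eq mult.commute)
      next
        case False
        then have "g (Diag x + fst p *\<^sub>R snd p) = \<infinity>"
          using elim by (intro spectral_pairD(2)[OF s] not_symmetric_add_scaleR) auto
        then show ?thesis using elim by (simp add: spectral_pairD(3)[OF s] b)
      qed
    qed
  qed
  finally show "ereal (inner y h) \<le> subderiv g (Diag x) H" .
qed

text \<open>Replacing \<open>h\<close> by \<open>hk\<close> in the diagonalized blocks and moving
  along the Cayley path yields matrices on which \<open>g\<close> takes exactly the values of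
  \<theta>. As \<open>Q\<close> commutes with \<open>Diag y\<close>, the linear terms agree up to
  the second-order remainder.\<close>

lemma spectral_recovery_sequence:
  assumes s: "spectral_pair g \<theta>" and x: "nonincreasing_vec x" and y: "nonincreasing_vec y"
    and b: "\<theta> x = ereal b" and H: "symmetric_mat H"
    and lim: "((\<lambda>t. eigs_quot x t H) \<longlongrightarrow> h) (at_right 0)"
    and le: "inner y h \<le> inner (Diag y) H"
    and t: "\<And>k. t k > 0" "t \<longlonglongrightarrow> 0" and hk: "hk \<longlonglongrightarrow> h"
  obtains Hk r M where "Hk \<longlonglongrightarrow> H" "r \<longlonglongrightarrow> curvature x y H"
    "\<And>k. sec_quot g (Diag x) (Diag y) (t k) (Hk k) = sec_quot \<theta> x y (t k) (hk k) + ereal (r k)"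
    "\<And>k. norm (Hk k - H) / t k \<le> norm (hk k - h) / t k + M"
proof -
  obtain Q where Q: "orthogonal_matrix Q" "block_mat (\<lambda>i. (x $ i, y $ i)) Q"
    and QB: "block_part (($) x) H = Q ** Diag h ** transpose Q"
    by (rule block_part_simultaneous_spectral[OF x y H lim le]) (rule that)
  let ?B = "block_part (($) x) H"
  have Qx: "Q ** Diag x ** transpose Q = Diag x" and Qy: "Q ** Diag y ** transpose Q = Diag y"
    by (rule block_mat_conj_Diag[OF Q(2,1)]; simp)+
  have Qyh: "inner (Diag y) (Q ** Diag w ** transpose Q) = inner y w" for w
    using inner_orthogonal_conj[OF Q(1), of "Diag y" "Diag w"] by (simp add: Qy inner_Diag_Diag)
  have eq: "inner (Diag y) H = inner y h"
    using Qyh[of h] by (simp add: inner_Diag_block_part flip: QB)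
  define Bk where "Bk = (\<lambda>k. Q ** Diag (hk k) ** transpose Q)"
  have "Bk \<longlonglongrightarrow> Q ** Diag h ** transpose Q"
    unfolding Bk_def by (intro tendsto_matrix_mult tendsto_const tendsto_Diag hk)
  then have Bk: "Bk \<longlonglongrightarrow> ?B" by (simp add: QB)
  obtain E where E: "(\<lambda>k. path_rem x H (t k) (Bk k)) \<longlonglongrightarrow> E" "\<And>y. 2 * inner (Diag y) E = - curvature x y H"
    by (rule tendsto_path_rem[OF H t(2) Bk]) (rule that)
  define e where "e = (\<lambda>k. path_rem x H (t k) (Bk k))"
  have e: "e \<longlonglongrightarrow> E" using E by (simp add: e_def)
  \<comment> \<open>Chosen so that \<open>Diag x + t k *\<^sub>R Hk k\<close> is exactly the Cayley
    conjugate of \<open>Diag x + t k *\<^sub>R Bk k\<close>.\<close>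
  define Hk where "Hk = (\<lambda>k. Bk k + H - ?B + t k *\<^sub>R e k)"
  have "Hk \<longlonglongrightarrow> ?B + H - ?B + 0 *\<^sub>R E"
    unfolding Hk_def by (intro tendsto_intros Bk t e)
  then have HkH: "Hk \<longlonglongrightarrow> H" by simp
  have g: "g (Diag x + t k *\<^sub>R Hk k) = \<theta> (x + t k *\<^sub>R hk k)" for k
  proof -
    let ?P = "cayley (off_gen x H) (t k)"
    have P: "orthogonal_matrix ?P" by (rule orthogonal_cayley[OF transpose_off_gen[OF H]])
    have "Diag x + t k *\<^sub>R Hk k = ?P ** (Diag x + t k *\<^sub>R Bk k) ** transpose ?P"
      unfolding path_expansion[OF H] Hk_def e_def by (simp add: scaleR_add_right power2_eq_square)
    also have "Diag x + t k *\<^sub>R Bk k = Q ** Diag (x + t k *\<^sub>R hk k) ** transpose Q"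
      by (simp add: Diag_add Diag_scaleR matrix_mult_bilinear Bk_def Qx)
    finally show ?thesis by (simp add: spectral_conj[OF s] P Q(1) spectral_pairD(3)[OF s])
  qed
  have inner_Hk: "inner (Diag y) (Hk k) = inner y (hk k) + t k * inner (Diag y) (e k)" for k
    unfolding Hk_def by (simp add: inner_add_right inner_diff_right inner_Diag_block_part Bk_def Qyh)
  \<comment> \<open>In the difference of the two quotients \<open>inner y (hk k)\<close> cancels,
    and only the remainder \<open>e k\<close> is left.\<close>
  define r where "r = (\<lambda>k. - 2 * inner (Diag y) (e k))"
  have "r \<longlonglongrightarrow> - 2 * inner (Diag y) E" unfolding r_def by (intro tendsto_intros e)
  then have r: "r \<longlonglongrightarrow> curvature x y H" using E(2)[of y] by simp
  have quot: "sec_quot g (Diag x) (Diag y) (t k) (Hk k) = sec_quot \<theta> x y (t k) (hk k) + ereal (r k)" for k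
  proof -
    have rk: "r k = (t k * inner y (hk k) - t k * inner (Diag y) (Hk k)) / ((t k)\<^sup>2 / 2)"
      using t(1)[of k] by (simp add: r_def inner_Hk power2_eq_square field_simps)
    show ?thesis
      unfolding sec_quot_def g spectral_pairD(3)[OF s] b rk
      using t(1)[of k] by (intro ereal_quot_shift spectral_pairD(4)[OF s]) simp
  qed
  \<comment> \<open>The remainder converges and is therefore bounded; it adds at most this constant
    to the rate of \<open>hk\<close>.\<close>
  obtain M where M: "\<And>k. norm (e k) \<le> M"
    using convergent_imp_Bseq[of e] e by (auto simp: convergent_def Bseq_def)
  have "norm (Hk k - H) / t k \<le> norm (hk k - h) / t k + M" for k
  proof -
    have "Hk k - H = Q ** Diag (hk k - h) ** transpose Q + t k *\<^sub>R e k"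
      by (simp add: Hk_def Bk_def QB Diag_diff matrix_mult_bilinear)
    then have "norm (Hk k - H) \<le> norm (Q ** Diag (hk k - h) ** transpose Q) + norm (t k *\<^sub>R e k)"
      by (simp only: norm_triangle_ineq)
    also have "\<dots> = norm (hk k - h) + t k * norm (e k)"
      using t(1)[of k] Q(1) by (simp add: norm_orthogonal_mult norm_Diag)
    also have "\<dots> \<le> norm (hk k - h) + t k * M"
      using t(1)[of k] M by (intro add_left_mono mult_left_mono) auto
    finally show ?thesis using t(1)[of k] by (simp add: field_simps)
  qed
  then show thesis using that[OF HkH r quot] by blast
qed

lemma spectral_second_order_Diag:
  assumes s: "spectral_pair g \<theta>" and x: "nonincreasing_vec x" and y: "nonincreasing_vec y"
    and sub: "Diag y \<in> subdiff g (Diag x)" and reg: "par_regular_for \<theta> x y"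
  shows "H \<in> critical_cone g (Diag x) (Diag y) \<Longrightarrow>
      sec_subderiv g (Diag x) (Diag y) H =
      sec_subderiv \<theta> x y (eigs_dir (Diag x) H) + ereal (curvature x y H)"
    and "par_regular_for g (Diag x) (Diag y)"
proof -
  have sub': "y \<in> subdiff \<theta> x" by (rule subdiff_Diag[OF s sub])
  obtain b where b: "\<theta> x = ereal b" using subdiff_finite[OF sub'] by blast
  \<comment> \<open>Both conclusions are proved together, because a critical direction and one with
    finite second subderivative enter only through the inequality \<open>le\<close>.\<close>
  have main: "sec_subderiv g (Diag x) (Diag y) H =
      sec_subderiv \<theta> x y (eigs_dir (Diag x) H) + ereal (curvature x y H) \<and>
    (sec_subderiv g (Diag x) (Diag y) H < \<infinity> \<longrightarrow>
     (\<exists>t wk. (\<forall>k. t k > 0) \<and> t \<longlonglongrightarrow> 0 \<and> wk \<longlonglongrightarrow> H \<and>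
        (\<lambda>k. sec_quot g (Diag x) (Diag y) (t k) (wk k)) \<longlonglongrightarrow> sec_subderiv g (Diag x) (Diag y) H \<and>
        limsup (\<lambda>k. ereal (norm (wk k - H) / t k)) < \<infinity>))"
    if H: "symmetric_mat H" and fin: "sec_subderiv g (Diag x) (Diag y) H < \<infinity> \<or> subderiv g (Diag x) H \<le> ereal (inner (Diag y) H)"
    for H
  proof -
    obtain h where lim: "((\<lambda>p. eigs_quot x (fst p) (sym_retract H (snd p))) \<longlongrightarrow> h) (at_right 0 \<times>\<^sub>F nhds H)"
      and lim0: "((\<lambda>t. eigs_quot x t H) \<longlongrightarrow> h) (at_right 0)" and dir: "eigs_dir (Diag x) H = h"
      by (rule eigs_quot_limit[OF x H]) (rule that)
    note lower = spectral_lower_bounds[OF s x y sub' H lim]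
    have le: "inner y h \<le> inner (Diag y) H"
      using fin lower(2) order_trans[OF lower(3)] by force
    show ?thesis
    proof (cases "sec_subderiv \<theta> x y h < \<infinity>")
      case False
      \<comment> \<open>The lower bound makes both sides infinite, and the regularity claim is
        vacuous.\<close>
      then show ?thesis using lower(1) by (simp add: dir)
    next
      case True
      then obtain t hk where t: "\<And>k. t k > 0" "t \<longlonglongrightarrow> 0" and hk: "hk \<longlonglongrightarrow> h"
        and q: "(\<lambda>k. sec_quot \<theta> x y (t k) (hk k)) \<longlonglongrightarrow> sec_subderiv \<theta> x y h"
        and bd: "limsup (\<lambda>k. ereal (norm (hk k - h) / t k)) < \<infinity>"
        using reg unfolding par_regular_for_def by blast
      obtain Hk r M where Hk: "Hk \<longlonglongrightarrow> H" and r: "r \<longlonglongrightarrow> curvature x y H"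
        and quot: "\<And>k. sec_quot g (Diag x) (Diag y) (t k) (Hk k) = sec_quot \<theta> x y (t k) (hk k) + ereal (r k)"
        and M: "\<And>k. norm (Hk k - H) / t k \<le> norm (hk k - h) / t k + M"
        by (rule spectral_recovery_sequence[OF s x y b H lim0 le t hk]) (rule that)
      have qg: "(\<lambda>k. sec_quot g (Diag x) (Diag y) (t k) (Hk k)) \<longlonglongrightarrow> sec_subderiv \<theta> x y h + ereal (curvature x y H)"
        unfolding quot using q r by (intro tendsto_add_ereal_general) auto
      from sec_subderiv_le_lim[OF t Hk qg] lower(1)
      have eq: "sec_subderiv g (Diag x) (Diag y) H = sec_subderiv \<theta> x y h + ereal (curvature x y H)"
        by (rule antisym)
      have "limsup (\<lambda>k. ereal (norm (Hk k - H) / t k)) \<le> limsup (\<lambda>k. ereal M + ereal (norm (hk k - h) / t k))"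
        using M by (intro Limsup_mono always_eventually allI) (simp add: add.commute)
      also have "\<dots> = ereal M + limsup (\<lambda>k. ereal (norm (hk k - h) / t k))"
        by (rule Limsup_add_ereal_left) auto
      also have "\<dots> < \<infinity>" using bd by simp
      finally show ?thesis using eq qg t Hk dir by auto
    qed
  qed
  show "sec_subderiv g (Diag x) (Diag y) H =
      sec_subderiv \<theta> x y (eigs_dir (Diag x) H) + ereal (curvature x y H)"
    if "H \<in> critical_cone g (Diag x) (Diag y)" for H
  proof -
    have "subderiv g (Diag x) H = ereal (inner (Diag y) H)" using that by (simp add: critical_cone_def)
    moreover from this have "symmetric_mat H" using not_symmetric_derivatives(2)[OF s b, of H] by auto
    ultimately show ?thesis using main by simp
  qed
  show "par_regular_for g (Diag x) (Diag y)"
    unfolding par_regular_for_def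
  proof (intro allI impI)
    fix H assume fin: "sec_subderiv g (Diag x) (Diag y) H < \<infinity>"
    then have "symmetric_mat H" using not_symmetric_derivatives(1)[OF s b, of H "Diag y"] by auto
    from main[OF this] fin show "\<exists>t wk. (\<forall>k. t k > 0) \<and> t \<longlonglongrightarrow> 0 \<and> wk \<longlonglongrightarrow> H \<and>
        (\<lambda>k. sec_quot g (Diag x) (Diag y) (t k) (wk k)) \<longlonglongrightarrow> sec_subderiv g (Diag x) (Diag y) H \<and>
        limsup (\<lambda>k. ereal (norm (wk k - H) / t k)) < \<infinity>" by blast
  qed
qed

section \<open>Reduction to diagonal matrices\<close>

lemma subdiff_conj:
  assumes s: "spectral_pair g \<theta>" and Q: "orthogonal_matrix Q" and Y: "Y \<in> subdiff g X"
  shows "Q ** Y ** transpose Q \<in> subdiff g (Q ** X ** transpose Q)"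
proof -
  have "g X + ereal (inner (Q ** Y ** transpose Q) (W - Q ** X ** transpose Q)) \<le> g W" for W
  proof -
    let ?W = "transpose Q ** W ** Q"
    have W: "W = Q ** ?W ** transpose Q" by (simp add: matrix_mul_assoc orthogonal_matrixD[OF Q])
    have "W - Q ** X ** transpose Q = Q ** (?W - X) ** transpose Q"
      by (subst W) (simp only: matrix_mult_bilinear)
    then have "inner (Q ** Y ** transpose Q) (W - Q ** X ** transpose Q) = inner Y (?W - X)"
      by (simp only: inner_orthogonal_conj[OF Q])
    moreover have "g W = g ?W" by (subst W) (rule spectral_conj[OF s Q])
    moreover have "g X + ereal (inner Y (?W - X)) \<le> g ?W" using Y unfolding subdiff_def by blast
    ultimately show ?thesis by simp
  qed
  then show ?thesis
    using Y by (simp add: subdiff_def spectral_conj[OF s Q])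
qed

section \<open>Sign changes and simultaneous diagonalization with a subgradient\<close>

definition sign_flip :: "'n \<Rightarrow> real^'n^'n" where
  "sign_flip i = Diag (\<chi> j. if j = i then - 1 else 1)"

lemma orthogonal_sign_flip: "orthogonal_matrix (sign_flip i)"
  unfolding orthogonal_matrix sign_flip_def
  by (auto simp: vec_eq_iff Diag_mult_nth Diag_nth mat_def)

lemma sign_flip_conj_nth:
  "(sign_flip i ** A ** transpose (sign_flip i)) $ k $ l = (if (k = i) = (l = i) then A $ k $ l else - A $ k $ l)"
  by (simp add: sign_flip_def mult_Diag_nth Diag_mult_nth)

lemma subdiff_monotone:
  assumes "Y \<in> subdiff f X" "Y' \<in> subdiff f X'"
  shows "0 \<le> inner (Y - Y') (X - X')"
proof -
  obtain a b where a: "f X = ereal a" and b: "f X' = ereal b"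
    using subdiff_finite assms by blast
  have "f X + ereal (inner Y (X' - X)) \<le> f X'" "f X' + ereal (inner Y' (X - X')) \<le> f X"
    using assms unfolding subdiff_def by blast+
  then show ?thesis by (simp add: a b inner_diff)
qed

text \<open>Diagonalize \<open>X + Y\<close>: since the subdifferential is monotone, \<open>X\<close> is determined by \<open>X + Y\<close>,
  hence inherits its invariance under sign changes of the eigenvectors.\<close>
lemma subdiff_simultaneous_orth_diag:
  assumes s: "spectral_pair g \<theta>" and X: "symmetric_mat X" and Y: "symmetric_mat Y"
    and sub: "Y \<in> subdiff g X"
  obtains U where "U \<in> orth_diag X" "U \<in> orth_diag Y"
proof -
  have symZ: "symmetric_mat (X + Y)" by (rule symmetric_mat_add[OF X Y])
  obtain U where U: "U \<in> orth_diag (X + Y)" using orth_diag_nonempty(2)[OF symZ] by blast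
  note U1 = orth_diagD[OF U]
  define z where "z = eigs (X + Y)"
  define A where "A = transpose U ** X ** U"
  define B where "B = transpose U ** Y ** U"
  have AB: "A + B = Diag z"
    using U1(3) by (simp add: A_def B_def z_def matrix_mult_bilinear)
  have BA: "B \<in> subdiff g A"
    using subdiff_conj[OF s _ sub, of "transpose U"] U1(1) by (simp add: A_def B_def)
  have off: "A $ i $ j = 0" if "i \<noteq> j" for i j
  proof -
    let ?S = "sign_flip i"
    let ?A = "?S ** A ** transpose ?S" and ?B = "?S ** B ** transpose ?S"
    \<comment> \<open>The sum is diagonal and so fixed by the sign change; \<open>A\<close> and
      \<open>B\<close> therefore change by opposite amounts, and monotonicity forces both changes to
      vanish.\<close>
    have "?A + ?B = ?S ** Diag z ** transpose ?S"
      unfolding AB[symmetric] by (simp only: matrix_mult_bilinear)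
    also have "\<dots> = A + B"
      unfolding AB vec_eq_iff sign_flip_conj_nth by (auto simp: Diag_nth)
    finally have eq: "B - ?B = - (A - ?A)" by (simp add: algebra_simps)
    have "0 \<le> inner (B - ?B) (A - ?A)"
      by (rule subdiff_monotone[OF BA subdiff_conj[OF s orthogonal_sign_flip BA]])
    then have "inner (A - ?A) (A - ?A) \<le> 0" unfolding eq inner_minus_left by simp
    then have "inner (A - ?A) (A - ?A) = 0" by (intro antisym inner_ge_zero)
    then have "A = ?A" by simp
    then have "A $ i $ j = ?A $ i $ j" by simp
    also have "\<dots> = - A $ i $ j" unfolding sign_flip_conj_nth using that by simp
    finally show ?thesis by simp
  qed
  define a where "a = (\<chi> i. A $ i $ i)"
  define b where "b = z - a"
  have A: "A = Diag a" using off by (auto simp: vec_eq_iff a_def Diag_nth)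
  have B: "B = Diag b" using AB by (simp add: A b_def Diag_diff algebra_simps)
  \<comment> \<open>The subgradient inequality at conjugates of \<open>A\<close>, where
    \<open>g\<close> keeps its value.\<close>
  have max: "inner (Diag b) (transpose Q ** Diag a ** Q) \<le> inner (Diag b) (Diag a)" if Q: "orthogonal_matrix Q" for Q
  proof -
    obtain c where c: "g A = ereal c" using subdiff_finite[OF BA] by blast
    have "g (transpose Q ** A ** Q) = g A" using spectral_conj[OF s, of "transpose Q" A] Q by simp
    moreover have "g A + ereal (inner B (transpose Q ** A ** Q - A)) \<le> g (transpose Q ** A ** Q)"
      using BA unfolding subdiff_def by blast
    ultimately show ?thesis using c unfolding A B by (simp add: inner_diff_right)
  qed
  \<comment> \<open>Maximality makes \<open>a\<close> and \<open>b\<close> vary in the same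
    direction, and their sum is sorted by the choice of \<open>U\<close>; hence each is
    sorted.\<close>
  have "a $ j \<le> a $ i \<and> b $ j \<le> b $ i" if ij: "i \<le> j" for i j
  proof (cases "i = j")
    case False
    have "0 \<le> (b $ i - b $ j) * (a $ i - a $ j)"
      using maximal_orthogonal_conj[of "Diag a" "\<lambda>_. ()" i j b, OF symmetric_mat_Diag refl False max]
      by (simp add: Diag_nth)
    moreover have "a $ j + b $ j \<le> a $ i + b $ i"
      using orth_diag_nonempty(1)[OF symZ] ij by (simp add: nonincreasing_vec_def b_def z_def)
    ultimately show ?thesis by (auto simp: zero_le_mult_iff)
  qed simp
  then have mono: "nonincreasing_vec a" "nonincreasing_vec b" by (auto simp: nonincreasing_vec_def)
  have XU: "X = U ** Diag a ** transpose U" and YU: "Y = U ** Diag b ** transpose U"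
    unfolding A[symmetric] B[symmetric] A_def B_def
    by (simp_all add: matrix_mul_assoc orthogonal_matrixD[OF U1(1)])
  then have "eigs X = a" "eigs Y = b" using eigs_eqI U1(1) mono by blast+
  then have "U \<in> orth_diag X" "U \<in> orth_diag Y" using XU YU U1(1) by (auto simp: orth_diag_def)
  then show thesis by (rule that)
qed

section \<open>The Moore-Penrose inverse and the curvature term in an eigenbasis\<close>

lemma mp_inv_eqI:
  fixes A B :: "real^'n^'n"
  assumes B: "A ** B ** A = A" "B ** A ** B = B"
    "transpose (A ** B) = A ** B" "transpose (B ** A) = B ** A"
  shows "mp_inv A = B"
  unfolding mp_inv_def
proof (rule the_equality)
  show "A ** B ** A = A \<and> B ** A ** B = B \<and> transpose (A ** B) = A ** B \<and> transpose (B ** A) = B ** A"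
    using B by blast
next
  fix C assume "A ** C ** A = A \<and> C ** A ** C = C \<and> transpose (A ** C) = A ** C \<and> transpose (C ** A) = C ** A"
  then have C: "A ** C ** A = A" "C ** A ** C = C"
    "transpose (A ** C) = A ** C" "transpose (C ** A) = C ** A" by blast+
  \<comment> \<open>Uniqueness: the symmetry conditions give equal products on either side of
    \<open>A\<close>, and then both inverses coincide with \<open>B ** A ** B\<close>.\<close>
  have "A ** B = (A ** C ** A) ** B" by (simp only: C)
  also have "\<dots> = transpose (A ** C) ** transpose (A ** B)" by (simp only: B(3) C(3) matrix_mul_assoc)
  also have "\<dots> = transpose (A ** B ** A ** C)"
    by (simp add: matrix_mul_assoc flip: matrix_transpose_mul)
  also have "\<dots> = A ** C" using B C by simp
  finally have AB: "A ** B = A ** C" .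
  have "B ** A = B ** (A ** C ** A)" by (simp only: C)
  also have "\<dots> = transpose (B ** A) ** transpose (C ** A)" by (simp only: B(4) C(4) matrix_mul_assoc)
  also have "\<dots> = transpose (C ** (A ** B ** A))"
    by (simp add: matrix_mul_assoc flip: matrix_transpose_mul)
  also have "\<dots> = C ** A" using B C by simp
  finally have BA: "B ** A = C ** A" .
  have "C = C ** A ** C" using C by simp
  also have "\<dots> = B ** (A ** C)" by (simp add: matrix_mul_assoc flip: BA)
  also have "\<dots> = B" using B by (simp add: matrix_mul_assoc flip: AB)
  finally show "C = B" .
qed

text \<open>In the eigenbasis the Penrose equations become scalar ones, and \<open>1 / 0 = 0\<close>
  is precisely the pseudoinverse of zero.\<close>

lemma mp_inv_shift:
  assumes U: "U \<in> orth_diag X"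
  shows "mp_inv (mu *\<^sub>R mat 1 - X) = U ** Diag (\<chi> k. 1 / (mu - eigs X $ k)) ** transpose U"
proof (rule mp_inv_eqI)
  define c where "c = (\<chi> k. mu - eigs X $ k)"
  define d where "d = (\<chi> k. 1 / (mu - eigs X $ k))"
  note U1 = orth_diagD[OF U]
  have "mu *\<^sub>R mat 1 = U ** (mu *\<^sub>R mat 1) ** transpose U"
    by (simp add: matrix_mult_bilinear orthogonal_matrixD[OF U1(1)])
  moreover have "mu *\<^sub>R mat 1 - Diag (eigs X) = Diag c"
    by (auto simp: c_def vec_eq_iff Diag_nth mat_def)
  ultimately have A: "mu *\<^sub>R mat 1 - X = U ** Diag c ** transpose U"
    using U1(2) by (metis matrix_mult_bilinear(3,4))
  have conj: "(U ** M ** transpose U) ** (U ** N ** transpose U) = U ** (M ** N) ** transpose U" for M N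
    by (simp add: matrix_mul_assoc orthogonal_matrixD[OF U1(1)])
  have D: "Diag c ** Diag d ** Diag c = Diag c" "Diag d ** Diag c ** Diag d = Diag d"
    "transpose (Diag c ** Diag d) = Diag c ** Diag d" "transpose (Diag d ** Diag c) = Diag d ** Diag c"
    by (auto simp: vec_eq_iff mult_Diag_nth Diag_nth c_def d_def transpose_nth)
  let ?B = "U ** Diag d ** transpose U"
  have T: "transpose (U ** M ** transpose U) = U ** transpose M ** transpose U" for M
    by (simp add: matrix_transpose_mul matrix_mul_assoc)
  show "(mu *\<^sub>R mat 1 - X) ** (U ** Diag (\<chi> k. 1 / (mu - eigs X $ k)) ** transpose U) ** (mu *\<^sub>R mat 1 - X) = mu *\<^sub>R mat 1 - X"
    "U ** Diag (\<chi> k. 1 / (mu - eigs X $ k)) ** transpose U ** (mu *\<^sub>R mat 1 - X) ** (U ** Diag (\<chi> k. 1 / (mu - eigs X $ k)) ** transpose U) =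
      U ** Diag (\<chi> k. 1 / (mu - eigs X $ k)) ** transpose U"
    "transpose ((mu *\<^sub>R mat 1 - X) ** (U ** Diag (\<chi> k. 1 / (mu - eigs X $ k)) ** transpose U)) =
      (mu *\<^sub>R mat 1 - X) ** (U ** Diag (\<chi> k. 1 / (mu - eigs X $ k)) ** transpose U)"
    "transpose (U ** Diag (\<chi> k. 1 / (mu - eigs X $ k)) ** transpose U ** (mu *\<^sub>R mat 1 - X)) =
      U ** Diag (\<chi> k. 1 / (mu - eigs X $ k)) ** transpose U ** (mu *\<^sub>R mat 1 - X)"
    unfolding A d_def[symmetric] conj T D by (rule refl)+
qed

text \<open>The factor \<open>Diag (eigs Y)\<close> leaves only diagonal entries of each block, and
  the index sets of the distinct eigenvalues partition all indices, so the sums merge into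
  one.\<close>

lemma sigma_term_eq_curvature:
  assumes U: "U \<in> orth_diag X" and H: "symmetric_mat H"
  shows "sigma_term X Y U H = curvature (eigs X) (eigs Y) (transpose U ** H ** U)"
proof -
  define x where "x = eigs X"
  define y where "y = eigs Y"
  define Ht where "Ht = transpose U ** H ** U"
  define M where "M = (\<lambda>mu. transpose U ** H ** mp_inv (mu *\<^sub>R mat 1 - X) ** H ** U)"
  have "transpose Ht = Ht"
    using symmetric_mat_conj[OF H, of "transpose U"] by (simp add: Ht_def symmetric_mat_def)
  then have M: "M mu = Ht ** Diag (\<chi> k. 1 / (mu - x $ k)) ** transpose Ht" for mu
    unfolding M_def mp_inv_shift[OF U] by (simp add: Ht_def x_def matrix_mul_assoc)
  have "(\<Sum>i\<in>eig_index X mu. \<Sum>j\<in>eig_index X mu. Diag y $ i $ j * M mu $ i $ j)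
      = (\<Sum>i\<in>{i\<in>UNIV. x $ i = mu}. y $ i * M (x $ i) $ i $ i)" for mu
    unfolding eig_index_def x_def[symmetric]
    by (intro sum.cong) (auto simp: Diag_nth if_distrib if_distribR sum.delta cong: if_cong)
  moreover have "transpose U ** H ** mp_inv (mu *\<^sub>R mat 1 - X) ** H ** U = M mu" for mu
    by (simp add: M_def)
  ultimately have "sigma_term X Y U H = 2 * (\<Sum>mu\<in>range (($) x). \<Sum>i\<in>{i\<in>UNIV. x $ i = mu}. y $ i * M (x $ i) $ i $ i)"
    unfolding sigma_term_def Let_def y_def[symmetric] x_def[symmetric]
    by (simp add: full_SetCompr_eq)
  also have "\<dots> = 2 * (\<Sum>i\<in>UNIV. y $ i * M (x $ i) $ i $ i)"
    by (subst sum.image_gen[symmetric]) auto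
  also have "\<dots> = curvature x y Ht"
    unfolding M conj_Diag_nth_diag curvature_def by (simp add: sum_distrib_left)
  finally show ?thesis by (simp add: x_def y_def Ht_def)
qed

section \<open>Invariance of derivatives and parabolic regularity under orthogonal
  conjugation\<close>

lemma sec_quot_conj:
  assumes s: "spectral_pair g \<theta>" and Q: "orthogonal_matrix Q"
  shows "sec_quot g (Q ** X ** transpose Q) (Q ** Y ** transpose Q) t (Q ** K ** transpose Q) = sec_quot g X Y t K"
proof -
  have "Q ** X ** transpose Q + t *\<^sub>R (Q ** K ** transpose Q) = Q ** (X + t *\<^sub>R K) ** transpose Q"
    by (simp add: matrix_mult_bilinear)
  then show ?thesis
    unfolding sec_quot_def by (simp only: inner_orthogonal_conj[OF Q] spectral_conj[OF s Q])
qed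

lemma tendsto_conj:
  fixes Q :: "real^'n^'n"
  assumes "(f \<longlongrightarrow> K) F" shows "((\<lambda>k. Q ** f k ** transpose Q) \<longlongrightarrow> Q ** K ** transpose Q) F"
  by (intro tendsto_matrix_mult tendsto_const assms)

text \<open>Conjugation is continuous with continuous inverse: one inequality is applied to
  \<open>Q\<close> and once more to its transpose.\<close>

lemma Liminf_conj:
  fixes Q :: "real^'n^'n" and f :: "real \<Rightarrow> real^'n^'n \<Rightarrow> ereal"
  assumes Q: "orthogonal_matrix Q" and fg: "\<And>t K. f t (Q ** K ** transpose Q) = f' t K"
  shows "Liminf (at_right 0 \<times>\<^sub>F nhds (Q ** H ** transpose Q)) (\<lambda>(t, K). f t K) =
    Liminf (at_right 0 \<times>\<^sub>F nhds H) (\<lambda>(t, K). f' t K)"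
proof (rule antisym)
  have le: "Liminf (at_right 0 \<times>\<^sub>F nhds (P ** H ** transpose P)) (\<lambda>(t, K). f t K) \<le>
    Liminf (at_right 0 \<times>\<^sub>F nhds H) (\<lambda>(t, K). f t (P ** K ** transpose P))"
    for P H :: "real^'n^'n" and f :: "real \<Rightarrow> real^'n^'n \<Rightarrow> ereal"
  proof -
    have "filterlim (\<lambda>p. (fst p, P ** snd p ** transpose P)) (at_right 0 \<times>\<^sub>F nhds (P ** H ** transpose P)) (at_right (0::real) \<times>\<^sub>F nhds H)"
      by (intro filterlim_Pair filterlim_fst) (rule tendsto_conj[OF filterlim_snd])
    from Liminf_filterlim[OF this, of "\<lambda>(t, K). f t K"] show ?thesis by (simp add: case_prod_unfold)
  qed
  from le[of Q H f] show "Liminf (at_right 0 \<times>\<^sub>F nhds (Q ** H ** transpose Q)) (\<lambda>(t, K). f t K) \<le>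
    Liminf (at_right 0 \<times>\<^sub>F nhds H) (\<lambda>(t, K). f' t K)" by (simp add: fg)
  have "f' t (transpose Q ** K ** Q) = f t K" for t K
    unfolding fg[symmetric] by (simp add: matrix_mul_assoc orthogonal_matrixD[OF Q])
  moreover have "transpose Q ** (Q ** H ** transpose Q) ** Q = H"
    by (simp add: matrix_mul_assoc orthogonal_matrixD[OF Q])
  ultimately show "Liminf (at_right 0 \<times>\<^sub>F nhds H) (\<lambda>(t, K). f' t K) \<le>
    Liminf (at_right 0 \<times>\<^sub>F nhds (Q ** H ** transpose Q)) (\<lambda>(t, K). f t K)"
    using le[of "transpose Q" "Q ** H ** transpose Q" f'] by simp
qed

lemma sec_subderiv_conj:
  assumes s: "spectral_pair g \<theta>" and Q: "orthogonal_matrix Q"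
  shows "sec_subderiv g (Q ** X ** transpose Q) (Q ** Y ** transpose Q) (Q ** H ** transpose Q) = sec_subderiv g X Y H"
  unfolding sec_subderiv_def by (rule Liminf_conj[OF Q]) (rule sec_quot_conj[OF s Q])

lemma subderiv_conj:
  assumes s: "spectral_pair g \<theta>" and Q: "orthogonal_matrix Q"
  shows "subderiv g (Q ** X ** transpose Q) (Q ** H ** transpose Q) = subderiv g X H"
  unfolding subderiv_def
proof (rule Liminf_conj[OF Q])
  fix t K
  have "Q ** X ** transpose Q + t *\<^sub>R (Q ** K ** transpose Q) = Q ** (X + t *\<^sub>R K) ** transpose Q"
    by (simp add: matrix_mult_bilinear)
  then show "(g (Q ** X ** transpose Q + t *\<^sub>R (Q ** K ** transpose Q)) - g (Q ** X ** transpose Q)) / ereal t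
      = (g (X + t *\<^sub>R K) - g X) / ereal t"
    by (simp only: spectral_conj[OF s Q])
qed

lemma par_regular_for_conj:
  assumes s: "spectral_pair g \<theta>" and Q: "orthogonal_matrix Q" and reg: "par_regular_for g X Y"
  shows "par_regular_for g (Q ** X ** transpose Q) (Q ** Y ** transpose Q)"
  unfolding par_regular_for_def
proof (intro allI impI)
  fix H
  let ?c = "\<lambda>K. Q ** K ** transpose Q" and ?H = "transpose Q ** H ** Q"
  have H: "H = ?c ?H" by (simp add: matrix_mul_assoc orthogonal_matrixD[OF Q])
  have eq: "sec_subderiv g (?c X) (?c Y) H = sec_subderiv g X Y ?H"
    by (subst H) (rule sec_subderiv_conj[OF s Q])
  assume "sec_subderiv g (?c X) (?c Y) H < \<infinity>"
  with reg obtain t wk where t: "\<forall>k. t k > 0" "t \<longlonglongrightarrow> 0" and wk: "wk \<longlonglongrightarrow> ?H"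
    and q: "(\<lambda>k. sec_quot g X Y (t k) (wk k)) \<longlonglongrightarrow> sec_subderiv g X Y ?H"
    and bd: "limsup (\<lambda>k. ereal (norm (wk k - ?H) / t k)) < \<infinity>"
    unfolding par_regular_for_def eq by blast
  have "norm (?c (wk k) - H) = norm (wk k - ?H)" for k
  proof -
    have "?c (wk k) - H = ?c (wk k - ?H)" by (subst H) (simp only: matrix_mult_bilinear)
    then show ?thesis using Q by (simp only: norm_orthogonal_mult orthogonal_matrix_transpose)
  qed
  moreover have "(\<lambda>k. ?c (wk k)) \<longlonglongrightarrow> H" using tendsto_conj[OF wk, of Q] H by simp
  ultimately show "\<exists>t wk. (\<forall>k. t k > 0) \<and> t \<longlonglongrightarrow> 0 \<and> wk \<longlonglongrightarrow> H \<and>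
        (\<lambda>k. sec_quot g (?c X) (?c Y) (t k) (wk k)) \<longlonglongrightarrow> sec_subderiv g (?c X) (?c Y) H \<and>
        limsup (\<lambda>k. ereal (norm (wk k - H) / t k)) < \<infinity>"
    using t q bd unfolding eq
    by (intro exI[of _ t] exI[of _ "\<lambda>k. ?c (wk k)"]) (simp add: sec_quot_conj[OF s Q])
qed

lemma eigs_dir_conj:
  assumes X: "symmetric_mat X" and H: "symmetric_mat H" and Q: "orthogonal_matrix Q"
  shows "eigs_dir (Q ** X ** transpose Q) (Q ** H ** transpose Q) = eigs_dir X H"
proof -
  have "eigs (Q ** X ** transpose Q + t *\<^sub>R (Q ** H ** transpose Q)) = eigs (X + t *\<^sub>R H)" for t
  proof -
    have "Q ** X ** transpose Q + t *\<^sub>R (Q ** H ** transpose Q) = Q ** (X + t *\<^sub>R H) ** transpose Q"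
      by (simp add: matrix_mult_bilinear)
    then show ?thesis
      by (simp only: eigs_conj[OF symmetric_mat_add[OF X symmetric_mat_scaleR[OF H]] Q])
  qed
  then show ?thesis unfolding eigs_dir_def by (simp add: eigs_conj[OF X Q])
qed

section \<open>Pinching\<close>

definition diag_vec :: "real^'n^'n \<Rightarrow> real^'n" where
  "diag_vec A = (\<chi> i. A $ i $ i)"

text \<open>Averaging \<open>A\<close> with its conjugate by a sign flip erases the off-diagonal entries of one row and column.\<close>
lemma spectral_pinching:
  assumes s: "spectral_pair g \<theta>" and cvx: "convex_efun g"
  shows "\<theta> (diag_vec A) \<le> g A"
proof -
  \<comment> \<open>The induction enlarges the set \<open>I\<close> of rows and columns already
    cleared off the diagonal; at \<open>UNIV\<close> only the diagonal of \<open>A\<close> is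
    left.\<close>
  define E where "E = (\<lambda>I. (\<chi> k l. if k \<noteq> l \<and> (k \<in> I \<or> l \<in> I) then 0 else A $ k $ l))"
  have "g (E I) \<le> g A" if "finite I" for I
    using that
  proof induction
    case empty
    have "E {} = A" by (simp add: E_def vec_eq_iff)
    then show ?case by simp
  next
    case (insert i I)
    let ?B = "sign_flip i ** E I ** transpose (sign_flip i)"
    have "E (insert i I) = (1 - 1/2) *\<^sub>R E I + (1/2) *\<^sub>R ?B"
      unfolding vec_eq_iff by (auto simp: sign_flip_conj_nth E_def)
    also have "g \<dots> \<le> ereal (1 - 1/2) * g (E I) + ereal (1/2) * g ?B"
      using cvx[unfolded convex_efun_def, THEN spec[of _ "E I"], THEN spec[of _ ?B], THEN spec[of _ "1/2"]]
      by simp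
    also have "g ?B = g (E I)" by (rule spectral_conj[OF s orthogonal_sign_flip])
    also have "ereal (1 - 1/2) * g (E I) + ereal (1/2) * g (E I) = g (E I)"
      by (cases "g (E I)") auto
    finally show ?case using insert.IH by (rule order_trans)
  qed
  from this[of UNIV] have "g (E UNIV) \<le> g A" by simp
  moreover have "E UNIV = Diag (diag_vec A)" by (auto simp: E_def vec_eq_iff Diag_nth diag_vec_def)
  ultimately show ?thesis by (simp add: spectral_pairD(3)[OF s])
qed

lemma bounded_linear_diag_vec: "bounded_linear diag_vec"
  unfolding linear_conv_bounded_linear[symmetric] by (simp add: linear_iff diag_vec_def vec_eq_iff)

lemma diag_vec_Diag: "diag_vec (Diag x) = x"
  by (simp add: diag_vec_def Diag_nth vec_eq_iff)

lemma inner_Diag_diag_vec: "inner (Diag y) A = inner y (diag_vec A)"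
  unfolding inner_Diag by (simp add: inner_vec_def diag_vec_def)

lemma norm_diag_vec_le: "norm (diag_vec A) \<le> norm A"
proof -
  have "inner (diag_vec A) (diag_vec A) \<le> inner A A"
    unfolding inner_matrix by (auto simp: inner_vec_def diag_vec_def intro!: sum_mono member_le_sum)
  then show ?thesis by (simp add: norm_eq_sqrt_inner)
qed

text \<open>Pairing with \<open>Diag v\<close> sees only diagonals, so pinching transfers the
  subgradient inequality from \<theta> to \<open>g\<close>.\<close>

lemma Diag_subdiff:
  assumes s: "spectral_pair g \<theta>" and cvx: "convex_efun g" and v: "v \<in> subdiff \<theta> x"
  shows "Diag v \<in> subdiff g (Diag x)"
proof -
  have "g (Diag x) + ereal (inner (Diag v) (W - Diag x)) \<le> g W" for W
  proof -
    have "\<theta> x + ereal (inner v (diag_vec W - x)) \<le> \<theta> (diag_vec W)"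
      using v unfolding subdiff_def by blast
    also have "\<dots> \<le> g W" by (rule spectral_pinching[OF s cvx])
    finally show ?thesis
      by (simp add: spectral_pairD(3)[OF s] inner_Diag_diag_vec diag_vec_Diag
          linear_diff[OF bounded_linear.linear[OF bounded_linear_diag_vec]])
  qed
  then show ?thesis using v by (simp add: subdiff_def spectral_pairD(3)[OF s])
qed

lemma sec_quot_diag_vec_le:
  assumes s: "spectral_pair g \<theta>" and cvx: "convex_efun g" and t: "t > 0" and b: "\<theta> x = ereal b"
  shows "sec_quot \<theta> x v t (diag_vec K) \<le> sec_quot g (Diag x) (Diag v) t K"
proof -
  have "diag_vec (Diag x + t *\<^sub>R K) = x + t *\<^sub>R diag_vec K"
    by (simp add: diag_vec_def Diag_nth vec_eq_iff)
  then have "\<theta> (x + t *\<^sub>R diag_vec K) \<le> g (Diag x + t *\<^sub>R K)"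
    using spectral_pinching[OF s cvx, of "Diag x + t *\<^sub>R K"] by simp
  then show ?thesis
    unfolding sec_quot_def spectral_pairD(3)[OF s] inner_Diag_diag_vec
    using t by (intro ereal_divide_right_mono ereal_minus_mono) auto
qed

text \<open>Diagonal directions give one inequality between the second subderivatives; pinching
  controls the quotients along the diagonals of a recovery sequence. Taking diagonals does not
  increase norms, so the rate survives.\<close>

lemma par_regular_for_Diag_imp:
  assumes s: "spectral_pair g \<theta>" and cvx: "convex_efun g" and b: "\<theta> x = ereal b"
    and reg: "par_regular_for g (Diag x) (Diag v)"
  shows "par_regular_for \<theta> x v"
  unfolding par_regular_for_def
proof (intro allI impI)
  fix w assume fin: "sec_subderiv \<theta> x v w < \<infinity>"
  have "filterlim (\<lambda>p. (fst p, Diag (snd p))) (at_right 0 \<times>\<^sub>F nhds (Diag w)) (at_right (0::real) \<times>\<^sub>F nhds w)"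
    by (intro filterlim_Pair filterlim_fst tendsto_Diag filterlim_snd)
  from Liminf_filterlim[OF this, of "\<lambda>(t, K). sec_quot g (Diag x) (Diag v) t K"]
  have le: "sec_subderiv g (Diag x) (Diag v) (Diag w) \<le> sec_subderiv \<theta> x v w"
    by (simp add: sec_subderiv_def sec_quot_def case_prod_unfold inner_Diag_Diag spectral_pairD(3)[OF s]
        flip: Diag_add Diag_scaleR)
  then have "sec_subderiv g (Diag x) (Diag v) (Diag w) < \<infinity>" using fin by (rule order.strict_trans1)
  then obtain t Hk where t: "\<And>k. t k > 0" "t \<longlonglongrightarrow> 0" and Hk: "Hk \<longlonglongrightarrow> Diag w"
    and q: "(\<lambda>k. sec_quot g (Diag x) (Diag v) (t k) (Hk k)) \<longlonglongrightarrow> sec_subderiv g (Diag x) (Diag v) (Diag w)"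
    and bd: "limsup (\<lambda>k. ereal (norm (Hk k - Diag w) / t k)) < \<infinity>"
    using reg unfolding par_regular_for_def by blast
  define wk where "wk = (\<lambda>k. diag_vec (Hk k))"
  have wk: "wk \<longlonglongrightarrow> w"
    using bounded_linear.tendsto[OF bounded_linear_diag_vec Hk] by (simp add: wk_def diag_vec_Diag)
  let ?q = "\<lambda>k. sec_quot \<theta> x v (t k) (wk k)"
  have "limsup ?q \<le> limsup (\<lambda>k. sec_quot g (Diag x) (Diag v) (t k) (Hk k))"
    unfolding wk_def by (intro Limsup_mono always_eventually allI sec_quot_diag_vec_le[OF s cvx _ b] t)
  also have "\<dots> = sec_subderiv g (Diag x) (Diag v) (Diag w)" by (intro lim_imp_Limsup q) simp
  also note le
  finally have upper: "limsup ?q \<le> sec_subderiv \<theta> x v w" .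
  have lower: "sec_subderiv \<theta> x v w \<le> liminf ?q"
    using Liminf_filterlim[OF filterlim_sequence_at_right_nhds[OF t wk], of "\<lambda>(t, w'). sec_quot \<theta> x v t w'"]
    by (simp add: sec_subderiv_def)
  \<comment> \<open>Squeeze: the definition of the second subderivative bounds the lower limit, and
    pinching bounds the upper one.\<close>
  have lim: "?q \<longlonglongrightarrow> sec_subderiv \<theta> x v w"
    using upper lower Liminf_le_Limsup[of sequentially ?q]
    by (intro limsup_le_liminf_real Liminf_eq_Limsup) auto
  have "limsup (\<lambda>k. ereal (norm (wk k - w) / t k)) \<le> limsup (\<lambda>k. ereal (norm (Hk k - Diag w) / t k))"
  proof (intro Limsup_mono always_eventually allI)
    fix k
    have "wk k - w = diag_vec (Hk k - Diag w)"
      by (simp add: wk_def linear_diff[OF bounded_linear.linear[OF bounded_linear_diag_vec]] diag_vec_Diag)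
    then show "ereal (norm (wk k - w) / t k) \<le> ereal (norm (Hk k - Diag w) / t k)"
      using t(1)[of k] norm_diag_vec_le[of "Hk k - Diag w"] by (simp add: divide_right_mono)
  qed
  also note bd
  finally show "\<exists>t wk. (\<forall>k. t k > 0) \<and> t \<longlonglongrightarrow> 0 \<and> wk \<longlonglongrightarrow> w \<and>
        (\<lambda>k. sec_quot \<theta> x v (t k) (wk k)) \<longlonglongrightarrow> sec_subderiv \<theta> x v w \<and>
        limsup (\<lambda>k. ereal (norm (wk k - w) / t k)) < \<infinity>"
    using t wk lim by blast
qed

section \<open>Transfer from diagonal matrices to arbitrary symmetric matrices\<close>

theorem theorem5p8:
  fixes g :: "real^('n::{finite,wellorder})^('n::{finite,wellorder}) \<Rightarrow> ereal"
    and \<theta> :: "real^('n::{finite,wellorder}) \<Rightarrow> ereal"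
    and X :: "real^('n::{finite,wellorder})^('n::{finite,wellorder})"
  assumes spectral: "\<forall>A. g A = (if symmetric_mat A then \<theta> (eigs A) else \<infinity>)"
    and theta_def: "\<forall>x. \<theta> x = g (Diag x)"
    and proper: "\<forall>A. g A \<noteq> -\<infinity>"
    and lip: "loc_lipschitz_rel_dom g"
    and lsc: "lsc_efun g"
    and cvx: "convex_efun g"
    and symX: "symmetric_mat X"
  shows "(\<forall>Y. symmetric_mat Y \<and> Y \<in> subdiff g X \<and>
            par_regular_for \<theta> (eigs X) (eigs Y) \<and> par_epi_diff \<theta> (eigs X) \<longrightarrow>
            par_regular_for g X Y \<and>
            (\<forall>H\<in>critical_cone g X Y. \<forall>U\<in>orth_diag X \<inter> orth_diag Y.
               sec_subderiv g X Y H =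
                 sec_subderiv \<theta> (eigs X) (eigs Y) (eigs_dir X H) + ereal (sigma_term X Y U H)))
       \<and> (par_epi_diff g X \<and> par_regular g X \<longrightarrow> par_regular \<theta> (eigs X))"
proof (intro conjI allI impI)
  have s: "spectral_pair g \<theta>"
    unfolding spectral_pair_def by (intro conjI spectral theta_def proper)
  have x: "nonincreasing_vec (eigs X)" by (rule orth_diag_nonempty(1)[OF symX])
  {
    fix Y assume asm: "symmetric_mat Y \<and> Y \<in> subdiff g X \<and>
      par_regular_for \<theta> (eigs X) (eigs Y) \<and> par_epi_diff \<theta> (eigs X)"
    then have symY: "symmetric_mat Y" and sub: "Y \<in> subdiff g X"
      and reg: "par_regular_for \<theta> (eigs X) (eigs Y)" by auto
    have y: "nonincreasing_vec (eigs Y)" by (rule orth_diag_nonempty(1)[OF symY])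
    have sub_Diag: "Diag (eigs Y) \<in> subdiff g (Diag (eigs X))"
      if U: "U \<in> orth_diag X" "U \<in> orth_diag Y" for U
      using subdiff_conj[OF s _ sub, of "transpose U"] orth_diagD(1,3)[OF U(1)] orth_diagD(3)[OF U(2)] by simp
    obtain U where U: "U \<in> orth_diag X" "U \<in> orth_diag Y"
      by (rule subdiff_simultaneous_orth_diag[OF s symX symY sub])
    show "par_regular_for g X Y"
      using par_regular_for_conj[OF s orth_diagD(1)[OF U(1)]
          spectral_second_order_Diag(2)[OF s x y sub_Diag[OF U] reg]]
      by (simp flip: orth_diagD(2)[OF U(1)] orth_diagD(2)[OF U(2)])
    show "\<forall>H\<in>critical_cone g X Y. \<forall>U\<in>orth_diag X \<inter> orth_diag Y.
               sec_subderiv g X Y H =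
                 sec_subderiv \<theta> (eigs X) (eigs Y) (eigs_dir X H) + ereal (sigma_term X Y U H)"
    proof (intro ballI)
      fix H U assume H: "H \<in> critical_cone g X Y" and "U \<in> orth_diag X \<inter> orth_diag Y"
      then have U: "U \<in> orth_diag X" "U \<in> orth_diag Y" by auto
      have Q: "orthogonal_matrix (transpose U)" using orth_diagD(1)[OF U(1)] by simp
      let ?H = "transpose U ** H ** U"
      have XY: "transpose U ** X ** transpose (transpose U) = Diag (eigs X)"
        "transpose U ** Y ** transpose (transpose U) = Diag (eigs Y)"
        using orth_diagD(3)[OF U(1)] orth_diagD(3)[OF U(2)] by simp_all
      have sd: "subderiv g (Diag (eigs X)) ?H = subderiv g X H"
        using subderiv_conj[OF s Q, of X H] by (simp add: XY del: transpose_transpose) simp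
      have crit: "?H \<in> critical_cone g (Diag (eigs X)) (Diag (eigs Y))"
        using H inner_orthogonal_conj[OF Q, of Y H] sd by (simp add: critical_cone_def orth_diagD(3)[OF U(2)])
      obtain b where "\<theta> (eigs X) = ereal b"
        using subdiff_finite[OF subdiff_Diag[OF s sub_Diag[OF U]]] by blast
      \<comment> \<open>A critical direction has a finite subderivative, which rules out
        nonsymmetric matrices.\<close>
      then have "symmetric_mat ?H"
        using not_symmetric_derivatives(2)[OF s, of "eigs X" b ?H] crit by (auto simp: critical_cone_def)
      then have symH: "symmetric_mat H"
        using symmetric_mat_conj_iff[OF Q, of H] by simp
      have "sec_subderiv g X Y H = sec_subderiv g (Diag (eigs X)) (Diag (eigs Y)) ?H"
        using sec_subderiv_conj[OF s Q, of X Y H] orth_diagD(3)[OF U(1)] orth_diagD(3)[OF U(2)] by simp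
      also have "\<dots> = sec_subderiv \<theta> (eigs X) (eigs Y) (eigs_dir (Diag (eigs X)) ?H)
          + ereal (curvature (eigs X) (eigs Y) ?H)"
        by (rule spectral_second_order_Diag(1)[OF s x y sub_Diag[OF U] reg crit])
      also have "eigs_dir (Diag (eigs X)) ?H = eigs_dir X H"
        using eigs_dir_conj[OF symX symH Q] orth_diagD(3)[OF U(1)] by simp
      also have "curvature (eigs X) (eigs Y) ?H = sigma_term X Y U H"
        by (rule sigma_term_eq_curvature[OF U(1) symH, symmetric])
      finally show "sec_subderiv g X Y H =
                 sec_subderiv \<theta> (eigs X) (eigs Y) (eigs_dir X H) + ereal (sigma_term X Y U H)" .
    qed
  }
  assume "par_epi_diff g X \<and> par_regular g X"
  then have reg: "par_regular g X" by blast
  show "par_regular \<theta> (eigs X)"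
    unfolding par_regular_def
  proof
    fix v assume v: "v \<in> subdiff \<theta> (eigs X)"
    then obtain b where b: "\<theta> (eigs X) = ereal b" using subdiff_finite by blast
    obtain U where U: "U \<in> orth_diag X" using orth_diag_nonempty(2)[OF symX] by blast
    let ?V = "U ** Diag v ** transpose U"
    \<comment> \<open>The subgradient of \<theta> is lifted to a diagonal matrix by pinching and
      rotated into the eigenbasis of \<open>X\<close>, so that regularity of \<open>g\<close> at
      \<open>X\<close> can be invoked.\<close>
    have "?V \<in> subdiff g X"
      using subdiff_conj[OF s orth_diagD(1)[OF U] Diag_subdiff[OF s cvx v]]
      by (simp flip: orth_diagD(2)[OF U])
    then have "par_regular_for g X ?V" using reg by (simp add: par_regular_def)
    from par_regular_for_conj[OF s _ this, of "transpose U"]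
    have "par_regular_for g (Diag (eigs X)) (Diag v)"
      using orth_diagD(1,3)[OF U] by (simp add: matrix_mul_assoc orthogonal_matrixD[OF orth_diagD(1)[OF U]])
    then show "par_regular_for \<theta> (eigs X) v"
      by (rule par_regular_for_Diag_imp[OF s cvx b])
  qed
qed

end
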